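(* Let $\Pi$ be an $\mathsf{LCL}$ problem having a certificate for $O(\log n)$ solvability. Then $\Pi$ is solvable in $O(\log n)$ rounds in the $\mathsf{CONGEST}$ model (on $n$-node full $\delta$-ary rooted trees).
   Context: An $\mathsf{LCL}$ problem is a triple $\Pi=(\delta,\Sigma,\mathcal C)$ where $\delta\ge 1$ is an integer, $\Sigma$ is a finite set of labels, and $\mathcal C\subseteq\Sigma^{\delta+1}$ is a set of allowed configurations, written $(a:b_1,\dots,b_\delta)$; the order of $b_1,\dots,b_\delta$ is irrelevant. Inputs are unlabeled full $\delta$-ary rooted trees (every node has exactly $\delta$ or $0$ children). A solution on a tree $T$ is a labeling $\lambda:V(T)\to\Sigma$ such that for every node $v$ with $\delta$ children $v_1,\dots,v_\delta$ there is a permutation $\rho$ of $\{1,\dots,\delta\}$ with $(\lambda(v):\lambda(v_{\rho(1)}),\dots,\lambda(v_{\rho(\delta)}))\in\mathcal C$; leaves are unconstrained. The restriction of $\Pi$ to $\Sigma'\subseteq\Sigma$ is $(\delta,\Sigma',\mathcal C')$ where $\mathcal C'$ consists of all configurations of $\mathcal C$ using only labels in $\Sigma'$. The automaton $\mathcal M(\Pi)$ is the directed graph with vertex set $\Sigma$ and an edge $a\to b$ whenever some $(a:b_1,\dots,b_\delta)\in\mathcal C$ has $b=b_i$ for some $i$. A label $a$ is path-flexible in $\Pi$ if there is $K$ such that for all $k\ge K$ there is a walk from $a$ to $a$ of length exactly $k$ in $\mathcal M(\Pi)$; otherwise it is path-inflexible. Certificate for $O(\log n)$ solvability: let $\Pi_0=\Pi$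 and let $\Pi_{i+1}$ be the restriction of $\Pi_i$ to the labels that are path-flexible in $\Pi_i$; iterate until a fixed point $\Pi_i=\Pi_{i-1}$ is reached. $\Pi$ has a certificate for $O(\log n)$ solvability iff the label set of the fixed point is nonempty. (The certificate itself is the restriction of the fixed point $\Pi_i$ to the labels of a minimal absorbing subgraph of $\mathcal M(\Pi_i)$, i.e. a strongly connected component without outgoing edges.) Model. In $\mathsf{CONGEST}$ on an $n$-node graph each node has a unique identifier from $\{1,\dots,\mathrm{poly}(n)\}$ and initially knows its identifier, its degree, $n$, the maximum degree, and which incident edge leads to its parent. In synchronous rounds nodes exchange $O(\log n)$-bit messages with neighbors and do unbounded local computation; each node eventually outputs its label. The running time is the number of rounds until all nodes have output. Algorithms are deterministic. *)

theory Defs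
  imports Complex_Main "HOL-Library.Landau_Symbols"
begin

section \<open>LCL problems and their certificates\<close>

text \<open>A configuration \<open>(a : b\<^sub>1, \<dots>, b\<^sub>\<delta>)\<close> is the pair \<open>(a, [b\<^sub>1, \<dots>, b\<^sub>\<delta>])\<close>.  The set of
  configurations need not be closed under permuting the list; that the order is irrelevant
  is part of the notion of a solution.\<close>

record 'a lcl =
  arity :: nat
  labels :: "'a set"
  configs :: "('a \<times> 'a list) set"

definition lcl_problem :: "'a lcl \<Rightarrow> bool" where
  "lcl_problem \<Pi> \<longleftrightarrow>
     arity \<Pi> \<ge> 1 \<and> finite (labels \<Pi>) \<and>
     (\<forall>(a, bs) \<in> configs \<Pi>. a \<in> labels \<Pi> \<and> set bs \<subseteq> labels \<Pi> \<and> length bs = arity \<Pi>)"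

definition restriction :: "'a lcl \<Rightarrow> 'a set \<Rightarrow> 'a lcl" where
  "restriction \<Pi> S =
     \<lparr>arity = arity \<Pi>, labels = S,
      configs = {(a, bs) \<in> configs \<Pi>. a \<in> S \<and> set bs \<subseteq> S}\<rparr>"

definition automaton :: "'a lcl \<Rightarrow> ('a \<times> 'a) set" where
  "automaton \<Pi> = {(a, b). \<exists>bs. (a, bs) \<in> configs \<Pi> \<and> b \<in> set bs}"

definition path_flexible :: "'a lcl \<Rightarrow> 'a \<Rightarrow> bool" where
  "path_flexible \<Pi> a \<longleftrightarrow> (\<exists>K. \<forall>k\<ge>K. (a, a) \<in> automaton \<Pi> ^^ k)"

definition prune :: "'a lcl \<Rightarrow> 'a lcl" where
  "prune \<Pi> = restriction \<Pi> {a \<in> labels \<Pi>. path_flexible \<Pi> a}"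

definition has_log_certificate :: "'a lcl \<Rightarrow> bool" where
  "has_log_certificate \<Pi> \<longleftrightarrow>
     (\<exists>i. (prune ^^ Suc i) \<Pi> = (prune ^^ i) \<Pi> \<and> labels ((prune ^^ i) \<Pi>) \<noteq> {})"


section \<open>Full rooted trees and solutions\<close>

text \<open>Nodes are natural numbers without loss of generality; these names are not visible to
  the algorithms, which only see the identifiers below.  The value of \<open>parent\<close> at the root
  (and outside of \<open>verts\<close>) carries no meaning.\<close>

record rtree =
  verts :: "nat set"
  root :: nat
  parent :: "nat \<Rightarrow> nat"

definition rooted_tree :: "'x rtree_scheme \<Rightarrow> bool" where
  "rooted_tree T \<longleftrightarrow>
     finite (verts T) \<and> root T \<in> verts T \<and>
     (\<forall>v \<in> verts T - {root T}. parent T v \<in> verts T) \<and>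
     (\<forall>v \<in> verts T. \<exists>k. (parent T ^^ k) v = root T)"

definition children :: "'x rtree_scheme \<Rightarrow> nat \<Rightarrow> nat set" where
  "children T v = {w \<in> verts T - {root T}. parent T w = v}"

definition full_tree :: "nat \<Rightarrow> 'x rtree_scheme \<Rightarrow> bool" where
  "full_tree d T \<longleftrightarrow>
     rooted_tree T \<and> (\<forall>v \<in> verts T. card (children T v) = d \<or> children T v = {})"

text \<open>The list \<open>vs\<close> ranges over all orderings \<open>v\<^bsub>\<rho>(1)\<^esub>, \<dots>, v\<^bsub>\<rho>(\<delta>)\<^esub>\<close> of the children of \<open>v\<close>.\<close>

definition solution :: "'a lcl \<Rightarrow> 'x rtree_scheme \<Rightarrow> (nat \<Rightarrow> 'a) \<Rightarrow> bool" where
  "solution \<Pi> T lab \<longleftrightarrow>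
     (\<forall>v \<in> verts T. lab v \<in> labels \<Pi>) \<and>
     (\<forall>v \<in> verts T. children T v \<noteq> {} \<longrightarrow>
        (\<exists>vs. distinct vs \<and> set vs = children T v \<and> (lab v, map lab vs) \<in> configs \<Pi>))"


section \<open>The CONGEST model on rooted trees\<close>

definition neighbours :: "'x rtree_scheme \<Rightarrow> nat \<Rightarrow> nat set" where
  "neighbours T v = children T v \<union> (if v = root T then {} else {parent T v})"

definition deg :: "'x rtree_scheme \<Rightarrow> nat \<Rightarrow> nat" where
  "deg T v = card (neighbours T v)"

text \<open>The incident edges of \<open>v\<close> are addressed by \<open>v\<close> through port numbers: port \<open>p\<close> leads to
  \<open>ports v ! p\<close>.  The port numbering is arbitrary.\<close>

record network = rtree +
  ident :: "nat \<Rightarrow> nat"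
  ports :: "nat \<Rightarrow> nat list"

definition valid_network :: "nat \<Rightarrow> nat \<Rightarrow> network \<Rightarrow> bool" where
  "valid_network d c N \<longleftrightarrow>
     full_tree d N \<and>
     inj_on (ident N) (verts N) \<and>
     ident N ` verts N \<subseteq> {1..card (verts N) ^ c} \<and>
     (\<forall>v \<in> verts N. distinct (ports N v) \<and> set (ports N v) = neighbours N v)"

definition port_to :: "network \<Rightarrow> nat \<Rightarrow> nat \<Rightarrow> nat" where
  "port_to N v w = (THE p. p < length (ports N v) \<and> ports N v ! p = w)"

record knowledge =
  own_id :: nat
  own_degree :: nat
  num_nodes :: nat
  max_degree :: nat
  parent_port :: "nat option"

definition initial_knowledge :: "network \<Rightarrow> nat \<Rightarrow> knowledge" where
  "initial_knowledge N v =
     \<lparr>own_id = ident N v,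
      own_degree = deg N v,
      num_nodes = card (verts N),
      max_degree = Max (deg N ` verts N),
      parent_port = (if v = root N then None else Some (port_to N v (parent N v)))\<rparr>"

type_synonym message = "bool list"

text \<open>Local computation is unbounded, so the state of a node may be taken to be its initial
  knowledge together with everything it has received so far: a chronological list with, for
  each round, the list of received messages indexed by port.  An algorithm determines from
  the state the message sent in the next round through each port (silence being the empty
  message), and whether a label is output.\<close>

type_synonym history = "message list list"

record 'a algorithm =
  send :: "knowledge \<Rightarrow> history \<Rightarrow> nat \<Rightarrow> message"
  out :: "knowledge \<Rightarrow> history \<Rightarrow> 'a option"

primrec history :: "'a algorithm \<Rightarrow> network \<Rightarrow> nat \<Rightarrow> nat \<Rightarrow> history" where
  "history A N 0 v = []"
| "history A N (Suc t) v = history A N t v @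
     [map (\<lambda>w. send A (initial_knowledge N w) (history A N t w) (port_to N w v)) (ports N v)]"

definition out_after :: "'a algorithm \<Rightarrow> network \<Rightarrow> nat \<Rightarrow> nat \<Rightarrow> 'a option" where
  "out_after A N t v = out A (initial_knowledge N v) (history A N t v)"

text \<open>An output is irrevocable: the first label that is output counts.  A node may keep
  forwarding messages afterwards.\<close>

definition output_label :: "'a algorithm \<Rightarrow> network \<Rightarrow> nat \<Rightarrow> 'a" where
  "output_label A N v = the (out_after A N (LEAST t. out_after A N t v \<noteq> None) v)"

definition terminates_within :: "'a algorithm \<Rightarrow> network \<Rightarrow> nat \<Rightarrow> bool" where
  "terminates_within A N t \<longleftrightarrow> (\<forall>v \<in> verts N. \<exists>s\<le>t. out_after A N s v \<noteq> None)"

definition message_size_bounded :: "'a algorithm \<Rightarrow> network \<Rightarrow> nat \<Rightarrow> bool" where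
  "message_size_bounded A N b \<longleftrightarrow>
     (\<forall>t. \<forall>v \<in> verts N. \<forall>p < deg N v.
        length (send A (initial_knowledge N v) (history A N t v) p) \<le> b)"

text \<open>Identifiers are taken from \<open>{1..n ^ c}\<close> for an arbitrary constant \<open>c\<close>; the algorithm
  and the constants hidden in the asymptotic bounds may depend on \<open>c\<close> (and on the problem).\<close>

definition congest_solvable :: "'a lcl \<Rightarrow> (nat \<Rightarrow> real) \<Rightarrow> bool" where
  "congest_solvable \<Pi> f \<longleftrightarrow>
     (\<forall>c. \<exists>(A :: 'a algorithm) (bits :: nat \<Rightarrow> nat) (rounds :: nat \<Rightarrow> nat).
        (\<lambda>n. real (bits n)) \<in> O(\<lambda>n. ln (real n)) \<and>
        (\<lambda>n. real (rounds n)) \<in> O(f) \<and>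
        (\<forall>N. valid_network (arity \<Pi>) c N \<longrightarrow>
           message_size_bounded A N (bits (card (verts N))) \<and>
           terminates_within A N (rounds (card (verts N))) \<and>
           solution \<Pi> N (output_label A N)))"

end

theory Submission
  imports Defs "HOL-Library.Log_Nat"
begin

text \<open>The fixed point contains a strongly connected set \<open>S\<close> of labels, a label \<open>a0 \<in> S\<close> and a
  bound \<open>K\<close> such that \<open>S\<close> has walks to \<open>a0\<close> of every length at least \<open>K\<close>.  So if some nodes are
  fixed in advance to \<open>a0\<close>, each of them being the lower end of its own vertical path of length
  at least \<open>K\<close>, then all other labels can be chosen from the parent's label, and the paths can be
  steered into \<open>a0\<close>.  This takes \<open>O(log n)\<close> rounds if one meets a fixed node (or the root)
  within \<open>O(log n)\<close> steps upwards from every node.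

  To find such nodes, every node collects the identifiers of its first \<open>O(log n)\<close> ancestors and
  simulates Cole--Vishkin colour reduction relative to its ancestors at distance \<open>1, \<dots>, m\<close>; local
  maxima of the combined colour yield cut nodes whose vertical distances are between \<open>m \<ge> K\<close> and a
  constant.  They split the tree into clusters of constant depth.  Let a cluster be on level
  \<open>t + 1\<close> if at least two of its child clusters are on level \<open>t\<close>; there are at most \<open>log n\<close>
  levels.  In each cluster one selects a child cluster of highest level and fixes its root to
  \<open>a0\<close>.  A child cluster that is not selected has a smaller highest level than its parent cluster,
  so one crosses only \<open>O(log n)\<close> clusters upwards before a fixed node is met.\<close>

section \<open>Walks to a fixed label in the pruning fixed point\<close>

section \<open>Flexible labels\<close>

lemma labels_prune_fixpoint:
  assumes "prune \<Pi> = \<Pi>" "a \<in> labels \<Pi>"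
  shows "path_flexible \<Pi> a"
proof -
  have "labels \<Pi> = labels (prune \<Pi>)" using assms(1) by simp
  also have "\<dots> = {a \<in> labels \<Pi>. path_flexible \<Pi> a}"
    by (simp add: prune_def restriction_def)
  finally show ?thesis using assms(2) by blast
qed

text \<open>Pruning only removes labels and configurations, so a configuration found in the fixed
  point is one of the original problem.\<close>

lemma funpow_prune:
  assumes "lcl_problem \<Pi>"
  shows "lcl_problem ((prune ^^ i) \<Pi>) \<and> labels ((prune ^^ i) \<Pi>) \<subseteq> labels \<Pi> \<and>
    configs ((prune ^^ i) \<Pi>) \<subseteq> configs \<Pi>"
proof (induction i)
  case (Suc i)
  then have "finite (labels ((prune ^^ i) \<Pi>))" by (simp add: lcl_problem_def)
  then have "finite {a \<in> labels ((prune ^^ i) \<Pi>). path_flexible ((prune ^^ i) \<Pi>) a}" by simp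
  with Suc show ?case
    by (auto simp: prune_def restriction_def lcl_problem_def)
qed (use assms in simp)

text \<open>A label whose set of reachable labels is smallest reaches exactly a minimal absorbing
  subgraph.\<close>

lemma absorbing_subset:
  fixes E :: "('a \<times> 'a) set"
  assumes "finite A" "A \<noteq> {}" "E \<subseteq> A \<times> A"
  obtains S where "S \<subseteq> A" "S \<noteq> {}" "\<And>a b. a \<in> S \<Longrightarrow> (a, b) \<in> E \<Longrightarrow> b \<in> S"
    "\<And>a b. a \<in> S \<Longrightarrow> b \<in> S \<Longrightarrow> (a, b) \<in> E\<^sup>*"
proof -
  define R where "R = (\<lambda>a. E\<^sup>* `` {a})"
  have R: "R a \<subseteq> A" if "a \<in> A" for a
  proof
    fix b assume "b \<in> R a"
    then have "(a, b) \<in> E\<^sup>*" by (simp add: R_def)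
    then show "b \<in> A" by (induction) (use that assms(3) in auto)
  qed
  obtain a where a: "a \<in> A" "\<And>b. b \<in> A \<Longrightarrow> card (R a) \<le> card (R b)"
    using assms(2) ex_has_least_nat[of "\<lambda>a. a \<in> A" _ "\<lambda>a. card (R a)"] by blast
  have fin: "finite (R a)" using R[OF a(1)] assms(1) finite_subset by blast
  have same: "R b = R a" if "b \<in> R a" for b
  proof -
    have "R b \<subseteq> R a" using that by (auto simp: R_def)
    moreover have "card (R a) \<le> card (R b)" using a R that by blast
    ultimately show ?thesis using fin card_seteq by blast
  qed
  show ?thesis
  proof (rule that[of "R a"])
    show "R a \<subseteq> A" using R a by blast
    show "R a \<noteq> {}" by (auto simp: R_def)
    show "b \<in> R a" if "c \<in> R a" "(c, b) \<in> E" for c b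
      using that by (auto simp: R_def)
    show "(c, b) \<in> E\<^sup>*" if "c \<in> R a" "b \<in> R a" for c b
      using same[OF that(1)] that(2) by (auto simp: R_def)
  qed
qed

text \<open>In a minimal absorbing set \<open>S\<close>, path-flexibility at \<open>a\<close>
  followed by one fixed walk from \<open>a\<close> to \<open>a0\<close> gives walks of all large
  lengths; a maximum over the finite set makes the threshold uniform. \<open>W j a\<close> stands
  for a walk of length \<open>j\<close> from \<open>a\<close> to \<open>a0\<close> and hides the
  automaton from the later argument.\<close>

lemma log_certificate_walks:
  fixes \<Pi> :: "'a lcl"
  assumes "lcl_problem \<Pi>" "has_log_certificate \<Pi>"
  obtains S a0 K and W :: "nat \<Rightarrow> 'a \<Rightarrow> bool" where
    "finite S" "S \<subseteq> labels \<Pi>" "a0 \<in> S"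
    "\<And>a j. a \<in> S \<Longrightarrow> j \<ge> K \<Longrightarrow> W j a"
    "\<And>a. W 0 a \<Longrightarrow> a = a0"
    "\<And>a j. a \<in> S \<Longrightarrow> W (Suc j) a \<Longrightarrow>
       \<exists>bs. (a, bs) \<in> configs \<Pi> \<and> set bs \<subseteq> S \<and> (\<exists>b \<in> set bs. W j b)"
proof -
  obtain i where i: "(prune ^^ Suc i) \<Pi> = (prune ^^ i) \<Pi>" "labels ((prune ^^ i) \<Pi>) \<noteq> {}"
    using assms(2) unfolding has_log_certificate_def by blast
  define \<Pi>' where "\<Pi>' = (prune ^^ i) \<Pi>"
  have fix': "prune \<Pi>' = \<Pi>'" and ne: "labels \<Pi>' \<noteq> {}" using i by (simp_all add: \<Pi>'_def)
  have lcl': "lcl_problem \<Pi>'" and lab': "labels \<Pi>' \<subseteq> labels \<Pi>" and cfg': "configs \<Pi>' \<subseteq> configs \<Pi>"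
    using funpow_prune[OF assms(1), of i] by (auto simp: \<Pi>'_def)
  define E where "E = automaton \<Pi>'"
  have "E \<subseteq> labels \<Pi>' \<times> labels \<Pi>'"
    using lcl' by (fastforce simp: E_def automaton_def lcl_problem_def)
  moreover have finL: "finite (labels \<Pi>')" using lcl' by (simp add: lcl_problem_def)
  ultimately obtain S where S: "S \<subseteq> labels \<Pi>'" "S \<noteq> {}"
    "\<And>a b. a \<in> S \<Longrightarrow> (a, b) \<in> E \<Longrightarrow> b \<in> S" "\<And>a b. a \<in> S \<Longrightarrow> b \<in> S \<Longrightarrow> (a, b) \<in> E\<^sup>*"
    using absorbing_subset[of "labels \<Pi>'" E] ne by blast
  have finS: "finite S" using S(1) finL finite_subset by blast
  obtain a0 where a0: "a0 \<in> S" using S(2) by blast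
  have "\<exists>K. \<forall>k\<ge>K. (a, a0) \<in> E ^^ k" if "a \<in> S" for a
  proof -
    have "path_flexible \<Pi>' a" using labels_prune_fixpoint[OF fix'] that S(1) by blast
    then obtain K where K: "\<And>k. k \<ge> K \<Longrightarrow> (a, a) \<in> E ^^ k"
      unfolding path_flexible_def E_def by blast
    have "(a, a0) \<in> E\<^sup>*" using S(4)[OF that a0] .
    then obtain l where l: "(a, a0) \<in> E ^^ l" using rtrancl_power by blast
    have "(a, a0) \<in> E ^^ k" if "k \<ge> K + l" for k
    proof -
      have "(a, a) \<in> E ^^ (k - l)" by (rule K) (use that in simp)
      then have "(a, a0) \<in> E ^^ (k - l) O E ^^ l" using l by blast
      then show ?thesis using that by (simp add: relpow_add[symmetric])
    qed
    then show ?thesis by blast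
  qed
  then obtain f where f: "\<And>a k. a \<in> S \<Longrightarrow> k \<ge> f a \<Longrightarrow> (a, a0) \<in> E ^^ k" by metis
  define W where "W = (\<lambda>j a. (a, a0) \<in> E ^^ j)"
  show ?thesis
  proof (rule that[of S a0 "Max (f ` S)" W])
    show "finite S" "S \<subseteq> labels \<Pi>" "a0 \<in> S" using finS S(1) lab' a0 by auto
    show "W j a" if "a \<in> S" "j \<ge> Max (f ` S)" for a j
    proof -
      have "f a \<le> j" using that finS by (meson Max_ge finite_imageI imageI le_trans)
      then show ?thesis using f[OF that(1)] by (simp add: W_def)
    qed
    show "a = a0" if "W 0 a" for a using that by (simp add: W_def)
    show "\<exists>bs. (a, bs) \<in> configs \<Pi> \<and> set bs \<subseteq> S \<and> (\<exists>b \<in> set bs. W j b)"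
      if a: "a \<in> S" and "W (Suc j) a" for a j
    proof -
      obtain b where b: "(a, b) \<in> E" "W j b"
        using \<open>W (Suc j) a\<close> relpow_Suc_D2[of a a0 j E] unfolding W_def by blast
      then obtain bs where bs: "(a, bs) \<in> configs \<Pi>'" "b \<in> set bs"
        by (auto simp: E_def automaton_def)
      \<comment> \<open>Absorption keeps the whole configuration in \<open>S\<close>, not only the
        label on the walk.\<close>
      have "set bs \<subseteq> S"
        using S(3)[OF a] bs(1) by (auto simp: E_def automaton_def)
      then show ?thesis using bs b(2) cfg' by blast
    qed
  qed
qed

section \<open>Cole--Vishkin colours along upward paths\<close>

section \<open>Vertical symmetry breaking\<close>

text \<open>The position of the lowest differing bit, paired with the own bit there. Equal colours
  do occur, since the identifier sequences become constant at the root; they use position 0.\<close>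

definition cv_step :: "nat \<Rightarrow> nat \<Rightarrow> nat" where
  "cv_step c c' =
     (let i = (if c = c' then 0 else LEAST i. bit c i \<noteq> bit c' i) in 2 * i + of_bool (bit c i))"

lemma bit_neq_exists:
  fixes c c' :: nat
  assumes "c < 2 ^ b" "c' < 2 ^ b" "c \<noteq> c'"
  shows "\<exists>i<b. bit c i \<noteq> bit c' i"
proof (rule ccontr)
  assume "\<not> ?thesis"
  then have "take_bit b c = take_bit b c'" by (auto simp: bit_eq_iff bit_take_bit_iff)
  then show False using assms by (simp add: take_bit_nat_eq_self)
qed

lemma cv_step_less:
  assumes "c < 2 ^ b" "c' < 2 ^ b" "b \<ge> 1"
  shows "cv_step c c' < 2 * b"
proof -
  define i where "i = (if c = c' then 0 else LEAST i. bit c i \<noteq> bit c' i)"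
  have "(LEAST i. bit c i \<noteq> bit c' i) < b" if neq: "c \<noteq> c'"
  proof -
    obtain i where i: "i < b" "bit c i \<noteq> bit c' i"
      using bit_neq_exists[OF assms(1,2) neq] by blast
    have "(LEAST i. bit c i \<noteq> bit c' i) \<le> i" by (rule Least_le) (rule i(2))
    then show ?thesis using i(1) by (rule le_less_trans)
  qed
  then have "i < b" using assms(3) by (simp add: i_def)
  moreover have "cv_step c c' = 2 * i + of_bool (bit c i)" by (simp add: cv_step_def i_def Let_def)
  ultimately show ?thesis by (cases "bit c i") simp_all
qed

text \<open>If both steps pick the same position, it is one at which \<open>c\<close> and
  \<open>c'\<close> differ, so the appended bits differ. The value \<open>e\<close> above may be
  arbitrary, which covers nodes close to the root.\<close>

lemma cv_step_neq:
  assumes "c \<noteq> c'"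
  shows "cv_step c c' \<noteq> cv_step c' e"
proof
  assume eq: "cv_step c c' = cv_step c' e"
  define i where "i = (LEAST i. bit c i \<noteq> bit c' i)"
  define j where "j = (if c' = e then 0 else LEAST i. bit c' i \<noteq> bit e i)"
  have "\<exists>i. bit c i \<noteq> bit c' i" using assms bit_eqI[of c c'] by blast
  then have i: "bit c i \<noteq> bit c' i" unfolding i_def by (rule LeastI_ex)
  have parity: "i = j \<and> p = q" if "2 * i + of_bool p = 2 * j + (of_bool q :: nat)" for i j p q
    using that by (cases i j rule: linorder_cases; cases p; cases q) simp_all
  have "2 * i + of_bool (bit c i) = 2 * j + (of_bool (bit c' j) :: nat)"
    using eq assms by (simp add: cv_step_def i_def j_def Let_def)
  then have "i = j \<and> bit c i = bit c' j" by (rule parity)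
  then show False using i by blast
qed

text \<open>A node is represented by the sequence \<open>x\<close> of the identifiers on its way up, which stays
  constant from the root on.  Colours are compared with the ancestor at distance \<open>d\<close>.\<close>

primrec cv_colour :: "nat \<Rightarrow> nat \<Rightarrow> (nat \<Rightarrow> nat) \<Rightarrow> nat" where
  "cv_colour d 0 x = x 0"
| "cv_colour d (Suc r) x = cv_step (cv_colour d r x) (cv_colour d r (\<lambda>i. x (i + d)))"

lemma cv_colour_cong:
  "(\<And>i. i \<le> r * d \<Longrightarrow> x i = y i) \<Longrightarrow> cv_colour d r x = cv_colour d r y"
proof (induction r arbitrary: x y)
  case (Suc r)
  have "cv_colour d r x = cv_colour d r y"
    by (rule Suc.IH, rule Suc.prems) simp
  moreover have "cv_colour d r (\<lambda>i. x (i + d)) = cv_colour d r (\<lambda>i. y (i + d))"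
    by (rule Suc.IH, rule Suc.prems) simp
  ultimately show ?case by simp
qed simp

text \<open>A colour of \<open>b\<close> bits becomes one below \<open>2 * b\<close>. So at least
  one bit is lost per round until 3 bits remain, and these are kept since 6 is at most 8. This slow
  rate suffices, as logarithmically many rounds are available.\<close>

lemma cv_colour_less:
  assumes "\<And>i. x i < 2 ^ (3 + m)"
  shows "cv_colour d r x < 2 ^ (3 + (m - r))"
  using assms
proof (induction r arbitrary: x)
  case (Suc r)
  have "cv_colour d (Suc r) x < 2 * (3 + (m - r))"
    unfolding cv_colour.simps
    by (rule cv_step_less; (rule Suc.IH)?) (use Suc.prems in simp_all)
  also have "\<dots> \<le> 2 ^ (3 + (m - Suc r))"
  proof (cases "m - r")
    case (Suc k)
    have "8 + 2 * k \<le> 8 * 2 ^ k" by (induction k) auto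
    moreover have "m - Suc r = k" using Suc by simp
    ultimately show ?thesis using Suc by (simp add: power_add)
  qed auto
  finally show ?case .
qed (use assms in simp)

text \<open>By \<open>cv_step_neq\<close>, two distinct colours stay distinct whatever the upper one
  is compared with. In the application, positions below \<open>h\<close> lie strictly below the
  root.\<close>

lemma cv_colour_neq:
  assumes "\<And>i j. i < h \<Longrightarrow> i < j \<Longrightarrow> x i \<noteq> x j" "d \<ge> 1" "i < h"
  shows "cv_colour d r (\<lambda>k. x (k + i)) \<noteq> cv_colour d r (\<lambda>k. x (k + (i + d)))"
proof (induction r)
  case 0
  show ?case using assms by simp
next
  case (Suc r)
  have eq: "(\<lambda>k. x (k + d + i)) = (\<lambda>k. x (k + (i + d)))" by (simp add: ac_simps)
  show ?case unfolding cv_colour.simps eq by (rule cv_step_neq[OF Suc])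
qed

text \<open>A base-8 number whose digits are the colours for the distances \<open>1\<close> to
  \<open>m\<close>. Two nodes at distance \<open>d\<close> on an upward path differ in the digit for
  \<open>d\<close>, so the codes separate all distances up to \<open>m\<close> at once.\<close>

primrec colour_code :: "nat \<Rightarrow> nat \<Rightarrow> (nat \<Rightarrow> nat) \<Rightarrow> nat" where
  "colour_code r 0 x = 0"
| "colour_code r (Suc m) x = 8 * colour_code r m x + cv_colour (Suc m) r x"

lemma colour_code_less:
  assumes "\<And>i. x i < 2 ^ (3 + r)"
  shows "colour_code r m x < 8 ^ m"
proof (induction m)
  case (Suc m)
  have "cv_colour (Suc m) r x < 8" using cv_colour_less[where r = r, OF assms] by simp
  then show ?case using Suc by simp
qed simp

lemma colour_code_inj:
  assumes "\<And>i. x i < 2 ^ (3 + r)" "\<And>i. y i < 2 ^ (3 + r)"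
    and "colour_code r m x = colour_code r m y" "d \<in> {1..m}"
  shows "cv_colour d r x = cv_colour d r y"
  using assms(3,4)
proof (induction m)
  case (Suc m)
  have less: "cv_colour (Suc m) r x < 8" "cv_colour (Suc m) r y < 8"
    using cv_colour_less[where r = r, OF assms(1)] cv_colour_less[where r = r, OF assms(2)] by simp_all
  have base8: "a = b \<and> c = e" if "8 * a + c = 8 * b + e" "c < 8" "e < 8" for a b c e :: nat
    using that by (cases a b rule: linorder_cases) linarith+
  have "colour_code r m x = colour_code r m y \<and> cv_colour (Suc m) r x = cv_colour (Suc m) r y"
    by (rule base8[OF _ less]) (use Suc.prems(1) in simp)
  moreover have "cv_colour d r x = cv_colour d r y" if "d \<noteq> Suc m"
    by (rule Suc.IH) (use calculation Suc.prems that in auto)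
  ultimately show ?case by blast
qed simp

lemma colour_code_cong:
  "(\<And>i. i \<le> r * m \<Longrightarrow> x i = y i) \<Longrightarrow> colour_code r m x = colour_code r m y"
proof (induction m)
  case (Suc m)
  have "cv_colour (Suc m) r x = cv_colour (Suc m) r y"
    by (rule cv_colour_cong) (rule Suc.prems, simp)
  moreover have "colour_code r m x = colour_code r m y"
    by (rule Suc.IH, rule Suc.prems) simp
  ultimately show ?case by simp
qed simp

text \<open>A node sees only its ancestors, so it tests whether the ancestor at distance
  \<open>m\<close> is a strict local maximum in the window from \<open>0\<close> to
  \<open>2 * m\<close>. The inequality of identifiers says that the ancestor at distance
  \<open>2 * m - 1\<close> is not the root, which keeps marks away from the root.\<close>

definition marked :: "nat \<Rightarrow> nat \<Rightarrow> (nat \<Rightarrow> nat) \<Rightarrow> bool" where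
  "marked m r x \<longleftrightarrow> x (2 * m - 1) \<noteq> x (2 * m) \<and>
     (\<forall>j\<le>2 * m. j \<noteq> m \<longrightarrow>
        colour_code r m (\<lambda>k. x (k + j)) < colour_code r m (\<lambda>k. x (k + m)))"

text \<open>Bounds how far up a node must look: for logarithmic \<open>r\<close>, logarithmically
  many identifiers suffice.\<close>

lemma marked_cong:
  assumes "\<And>i. i \<le> r * m + 2 * m \<Longrightarrow> x i = y i"
  shows "marked m r x = marked m r y"
proof -
  have "colour_code r m (\<lambda>k. x (k + j)) = colour_code r m (\<lambda>k. y (k + j))" if "j \<le> 2 * m" for j
    by (rule colour_code_cong) (use assms that in auto)
  moreover have "x (2 * m - 1) = y (2 * m - 1)" "x (2 * m) = y (2 * m)" using assms by auto
  ultimately show ?thesis by (simp add: marked_def)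
qed

text \<open>Two strict local maxima within distance \<open>m\<close> would each exceed the
  other.\<close>

lemma marked_spaced:
  assumes "marked m r (\<lambda>k. x (k + i))" "marked m r (\<lambda>k. x (k + j))" "i < j"
  shows "m < j - i"
proof (rule ccontr)
  assume *: "\<not> m < j - i"
  define C where "C = (\<lambda>p. colour_code r m (\<lambda>k. x (k + p)))"
  have mk: "C (j' + i') < C (m + i')"
    if "marked m r (\<lambda>k. x (k + i'))" "j' \<le> 2 * m" "j' \<noteq> m" for i' j'
    using that by (simp add: marked_def C_def add.assoc)
  have "C (m + (j - i) + i) < C (m + i)"
    by (rule mk[OF assms(1)]) (use * assms(3) in auto)
  moreover have "C (m - (j - i) + j) < C (m + j)"
    by (rule mk[OF assms(2)]) (use * assms(3) in auto)
  moreover have "m + (j - i) + i = m + j" "m - (j - i) + j = m + i" using * assms(3) by auto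
  ultimately show False by simp
qed

text \<open>Moving repeatedly to a larger colour within distance \<open>m\<close> ends, after fewer than \<open>8 ^ m\<close>
  moves, at a strict local maximum.\<close>

lemma local_maximum_exists:
  fixes C :: "nat \<Rightarrow> nat"
  assumes "\<And>p. C p < q" "\<And>p p'. p < p' \<Longrightarrow> p' \<le> h \<Longrightarrow> p' \<le> p + m \<Longrightarrow> C p \<noteq> C p'"
    and "m * (q - C p) + m \<le> p" "p + m * (q - C p) + m \<le> h"
  shows "\<exists>p'. m \<le> p' \<and> p' + m \<le> h \<and>
    (\<forall>s. s \<noteq> p' \<longrightarrow> p' \<le> s + m \<longrightarrow> s \<le> p' + m \<longrightarrow> C s < C p')"
  using assms(3,4)
proof (induction "q - C p" arbitrary: p rule: less_induct)
  case less
  show ?case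
  proof (cases "\<forall>s. s \<noteq> p \<longrightarrow> p \<le> s + m \<longrightarrow> s \<le> p + m \<longrightarrow> C s < C p")
    case True
    then show ?thesis using less.prems by (intro exI[of _ p]) auto
  next
    case False
    then obtain s where s: "s \<noteq> p" "p \<le> s + m" "s \<le> p + m" "C p \<le> C s" by (auto simp: not_less)
    have "C p \<noteq> C s"
    proof (cases "p < s")
      case True
      then show ?thesis using assms(2)[of p s] s less.prems by simp
    next
      case False
      then show ?thesis using assms(2)[of s p] s less.prems by force
    qed
    then have lt: "C p < C s" using s by simp
    then have "Suc (q - C s) \<le> q - C p" using assms(1)[of s] by simp
    \<comment> \<open>A move travels at most \<open>m\<close> and raises the colour by at least one,
      so the room needed on either side shrinks by at least \<open>m\<close>.\<close>
    then have "m * Suc (q - C s) \<le> m * (q - C p)" by (rule mult_le_mono2)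
    then have "m * (q - C s) + m \<le> m * (q - C p)" by simp
    then have "m * (q - C s) + m \<le> s" "s + m * (q - C s) + m \<le> h"
      using less.prems s by linarith+
    moreover have "q - C s < q - C p" using lt assms(1)[of s] by simp
    ultimately show ?thesis using less.hyps by blast
  qed
qed

lemma marked_exists:
  assumes "m \<ge> 1" "\<And>i. x i < 2 ^ (3 + r)" "\<And>i j. i < h \<Longrightarrow> i < j \<Longrightarrow> x i \<noteq> x j"
    and "2 * m * 8 ^ m + 2 * m \<le> h"
  shows "\<exists>i\<le>h. marked m r (\<lambda>k. x (k + i))"
proof -
  define C where "C = (\<lambda>p. colour_code r m (\<lambda>k. x (k + p)))"
  have less: "C p < 8 ^ m" for p
    unfolding C_def by (rule colour_code_less) (use assms(2) in simp)
  have neq: "C p \<noteq> C p'" if "p < p'" "p' \<le> h" "p' \<le> p + m" for p p'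
  proof
    assume "C p = C p'"
    then have "cv_colour (p' - p) r (\<lambda>k. x (k + p)) = cv_colour (p' - p) r (\<lambda>k. x (k + p'))"
      unfolding C_def by (intro colour_code_inj[where m = m]) (use assms(2) that in auto)
    moreover have "cv_colour (p' - p) r (\<lambda>k. x (k + p)) \<noteq>
        cv_colour (p' - p) r (\<lambda>k. x (k + (p + (p' - p))))"
      using cv_colour_neq[of h x "p' - p" p r] assms(3) that by auto
    ultimately show False using that by simp
  qed
  \<comment> \<open>The middle of the range: \<open>8 ^ m\<close> moves of length \<open>m\<close>
    and a final window of \<open>m\<close> fit on either side.\<close>
  define p where "p = m * 8 ^ m + m"
  have "m * (8 ^ m - C p) \<le> m * 8 ^ m" by simp
  then have "m * (8 ^ m - C p) + m \<le> p" "p + m * (8 ^ m - C p) + m \<le> h"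
    using assms(4) unfolding p_def by linarith+
  from local_maximum_exists[where C = C, OF less neq this] obtain p' where p': "m \<le> p'" "p' + m \<le> h"
    "\<And>s. s \<noteq> p' \<Longrightarrow> p' \<le> s + m \<Longrightarrow> s \<le> p' + m \<Longrightarrow> C s < C p'"
    by blast
  have "C (j + (p' - m)) < C (m + (p' - m))" if "j \<le> 2 * m" "j \<noteq> m" for j
    using p'(3)[of "j + (p' - m)"] that p'(1) by auto
  moreover have "x (2 * m - 1 + (p' - m)) \<noteq> x (2 * m + (p' - m))"
    by (rule assms(3)) (use p' assms(1) in linarith)+
  ultimately have "marked m r (\<lambda>k. x (k + (p' - m)))"
    by (simp add: marked_def C_def add.assoc)
  then show ?thesis using p'(2) by (intro exI[of _ "p' - m"]) auto
qed

section \<open>Sequential composition of computations with logarithmic bounds\<close>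

section \<open>Composing algorithms\<close>

text \<open>The common shape of the logarithmic bounds below. For \<open>n \<ge> 2\<close> the
  quotient \<open>ln n / ln 2\<close> is at least 1 and absorbs both \<open>b\<close> and the
  rounding in \<open>floorlog\<close>.\<close>

lemma log_bits_bigo:
  "(\<lambda>n. real (a * floorlog 2 n + b)) \<in> O(\<lambda>n. ln (real n))"
proof (rule bigoI[where c = "(2 * real a + real b) / ln 2"])
  have "norm (real (a * floorlog 2 n + b)) \<le> (2 * real a + real b) / ln 2 * norm (ln (real n))"
    if n: "n \<ge> 2" for n :: nat
  proof -
    have "ln 2 \<le> ln (real n)" using n by simp
    then have q: "1 \<le> ln (real n) / ln 2" by simp
    have "real (floorlog 2 n) \<le> ln (real n) / ln 2 + 1"
      using n q by (simp add: floorlog_def log_def)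
    then have "real (floorlog 2 n) \<le> 2 * (ln (real n) / ln 2)" using q by linarith
    then have "real a * real (floorlog 2 n) \<le> real a * (2 * (ln (real n) / ln 2))"
      by (rule mult_left_mono) simp
    moreover have "real b * 1 \<le> real b * (ln (real n) / ln 2)"
      using q by (rule mult_left_mono) simp
    ultimately have "real (a * floorlog 2 n + b) \<le> (2 * real a + real b) * (ln (real n) / ln 2)"
      by (simp add: algebra_simps)
    moreover have "norm (ln (real n)) = ln (real n)" using n by simp
    ultimately show ?thesis by simp
  qed
  then show "\<forall>\<^sub>F n in sequentially. norm (real (a * floorlog 2 n + b)) \<le>
      (2 * real a + real b) / ln 2 * norm (ln (real n))"
    using eventually_sequentially by blast
qed

lemma less_two_power_floorlog: "n < 2 ^ floorlog 2 n"
  by (rule floorlog_leD[of 2]) simp_all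

text \<open>The algorithm stops after exactly \<open>rounds n\<close> rounds at all nodes, so that another one can be
  started from its results.\<close>

definition congest_computable :: "nat \<Rightarrow> nat \<Rightarrow> (network \<Rightarrow> nat \<Rightarrow> 'b) \<Rightarrow> bool" where
  "congest_computable d c f \<longleftrightarrow>
     (\<exists>(A :: 'b algorithm) bits rounds.
        (\<lambda>n. real (bits n)) \<in> O(\<lambda>n. ln (real n)) \<and>
        (\<lambda>n. real (rounds n)) \<in> O(\<lambda>n. ln (real n)) \<and>
        (\<forall>N. valid_network d c N \<longrightarrow>
           (\<forall>v \<in> verts N.
              (\<forall>t < rounds (card (verts N)). \<forall>p < deg N v.
                 length (send A (initial_knowledge N v) (history A N t v) p)
                   \<le> bits (card (verts N))) \<and>
              out_after A N (rounds (card (verts N))) v = Some (f N v))))"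

lemma length_history [simp]: "length (history A N t v) = t"
  by (induction t) auto

lemma num_nodes_initial [simp]: "num_nodes (initial_knowledge N v) = card (verts N)"
  by (simp add: initial_knowledge_def)

lemma length_ports:
  assumes "valid_network d c N" "v \<in> verts N"
  shows "length (ports N v) = deg N v"
  using assms by (auto simp: valid_network_def deg_def distinct_card[symmetric])

lemma neighbours_in_verts:
  assumes "valid_network d c N" "v \<in> verts N" "w \<in> neighbours N v"
  shows "w \<in> verts N"
  using assms by (auto simp: valid_network_def full_tree_def rooted_tree_def neighbours_def
      children_def split: if_splits)

lemma set_ports:
  assumes "valid_network d c N" "v \<in> verts N"
  shows "set (ports N v) = neighbours N v"
  using assms by (simp add: valid_network_def)

lemma neighbours_sym:
  assumes "valid_network d c N" "v \<in> verts N" "w \<in> neighbours N v"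
  shows "v \<in> neighbours N w"
  using assms by (auto simp: valid_network_def full_tree_def rooted_tree_def neighbours_def
      children_def split: if_splits)

lemma port_to:
  assumes "valid_network d c N" "v \<in> verts N" "w \<in> neighbours N v"
  shows "port_to N v w < deg N v" "ports N v ! port_to N v w = w"
proof -
  have "distinct (ports N v)" "w \<in> set (ports N v)"
    using assms by (auto simp: valid_network_def)
  then have "\<exists>!p. p < length (ports N v) \<and> ports N v ! p = w"
    by (metis distinct_Ex1)
  from theI'[OF this] show "port_to N v w < deg N v" "ports N v ! port_to N v w = w"
    using length_ports[OF assms(1,2)] by (simp_all add: port_to_def)
qed

lemma port_to_nth:
  assumes "valid_network d c N" "v \<in> verts N" "p < deg N v"
  shows "port_to N v (ports N v ! p) = p"
proof -
  have p: "p < length (ports N v)" using assms length_ports by metis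
  then have "ports N v ! p \<in> neighbours N v"
    using set_ports[OF assms(1,2)] nth_mem by metis
  from port_to[OF assms(1,2) this] p show ?thesis
    using assms length_ports[OF assms(1,2)] by (metis nth_eq_iff_index_eq valid_network_def)
qed

lemma congest_computable_const: "congest_computable d c (\<lambda>N v. h)"
  unfolding congest_computable_def
  by (intro exI[of _ "\<lparr>send = \<lambda>k h p. [], out = \<lambda>k hs. Some h\<rparr>"] exI[of _ "\<lambda>n. 0"])
    (auto simp: out_after_def)

lemma congest_computable_cong:
  assumes "congest_computable d c f"
    and "\<And>N v. valid_network d c N \<Longrightarrow> v \<in> verts N \<Longrightarrow> f N v = g N v"
  shows "congest_computable d c g"
proof -
  from assms(1) obtain A :: "'a algorithm" and bits rounds where A:
    "(\<lambda>n. real (bits n)) \<in> O(\<lambda>n. ln (real n))" "(\<lambda>n. real (rounds n)) \<in> O(\<lambda>n. ln (real n))"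
    "\<And>N v. valid_network d c N \<Longrightarrow> v \<in> verts N \<Longrightarrow>
      (\<forall>t < rounds (card (verts N)). \<forall>p < deg N v.
         length (send A (initial_knowledge N v) (history A N t v) p) \<le> bits (card (verts N))) \<and>
      out_after A N (rounds (card (verts N))) v = Some (f N v)"
    unfolding congest_computable_def by blast
  show ?thesis unfolding congest_computable_def
    by (rule exI[of _ A], rule exI[of _ bits], rule exI[of _ rounds]) (use A assms(2) in auto)
qed

lemma congest_computable_map:
  assumes "congest_computable d c f"
  shows "congest_computable d c (\<lambda>N v. h (initial_knowledge N v) (f N v))"
proof -
  from assms obtain A :: "'a algorithm" and bits rounds where A:
    "(\<lambda>n. real (bits n)) \<in> O(\<lambda>n. ln (real n))" "(\<lambda>n. real (rounds n)) \<in> O(\<lambda>n. ln (real n))"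
    "\<And>N v. valid_network d c N \<Longrightarrow> v \<in> verts N \<Longrightarrow>
      (\<forall>t < rounds (card (verts N)). \<forall>p < deg N v.
         length (send A (initial_knowledge N v) (history A N t v) p) \<le> bits (card (verts N))) \<and>
      out_after A N (rounds (card (verts N))) v = Some (f N v)"
    unfolding congest_computable_def by blast
  define B where "B = \<lparr>send = send A, out = \<lambda>k hs. map_option (h k) (out A k hs)\<rparr>"
  have hist: "history B N t v = history A N t v" for N t v
    by (induction t arbitrary: v) (simp_all add: B_def)
  show ?thesis unfolding congest_computable_def
    by (rule exI[of _ B], rule exI[of _ bits], rule exI[of _ rounds])
      (use A hist in \<open>auto simp: B_def out_after_def\<close>)
qed

text \<open>\<open>congest_computable\<close> restricts neither outputs before the last round nor
  messages from that round on. So \<open>B\<close> outputs in exactly that round and is silent from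
  then on; its first, irrevocable output is then the intended one.\<close>

lemma congest_solvable_if_computable:
  assumes "\<And>c. \<exists>lab. congest_computable (arity \<Pi>) c lab \<and>
    (\<forall>N. valid_network (arity \<Pi>) c N \<longrightarrow> solution \<Pi> N (lab N))"
  shows "congest_solvable \<Pi> (\<lambda>n. ln (real n))"
  unfolding congest_solvable_def
proof
  fix c
  obtain lab where lab: "congest_computable (arity \<Pi>) c lab"
    "\<And>N. valid_network (arity \<Pi>) c N \<Longrightarrow> solution \<Pi> N (lab N)"
    using assms by blast
  from lab(1) obtain A :: "'a algorithm" and bits rounds where A:
    "(\<lambda>n. real (bits n)) \<in> O(\<lambda>n. ln (real n))" "(\<lambda>n. real (rounds n)) \<in> O(\<lambda>n. ln (real n))"
    "\<And>N v. valid_network (arity \<Pi>) c N \<Longrightarrow> v \<in> verts N \<Longrightarrow>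
      (\<forall>t < rounds (card (verts N)). \<forall>p < deg N v.
         length (send A (initial_knowledge N v) (history A N t v) p) \<le> bits (card (verts N))) \<and>
      out_after A N (rounds (card (verts N))) v = Some (lab N v)"
    unfolding congest_computable_def by blast
  define B where "B = \<lparr>
    send = \<lambda>k hs p. if length hs < rounds (num_nodes k) then send A k hs p else [],
    out = \<lambda>k hs. if length hs = rounds (num_nodes k) then out A k hs else None\<rparr>"
  have hist: "history B N t v = history A N t v" if "t \<le> rounds (card (verts N))" for N t v
    using that by (induction t arbitrary: v) (simp_all add: B_def)
  have out: "out_after B N t v = (if t = rounds (card (verts N)) then Some (lab N v) else None)"
    if "valid_network (arity \<Pi>) c N" "v \<in> verts N" for N t v
    using A(3)[OF that] hist[of t N v] by (auto simp: out_after_def B_def)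
  show "\<exists>(A :: 'a algorithm) bits rounds.
    (\<lambda>n. real (bits n)) \<in> O(\<lambda>n. ln (real n)) \<and> (\<lambda>n. real (rounds n)) \<in> O(\<lambda>n. ln (real n)) \<and>
    (\<forall>N. valid_network (arity \<Pi>) c N \<longrightarrow>
      message_size_bounded A N (bits (card (verts N))) \<and>
      terminates_within A N (rounds (card (verts N))) \<and> solution \<Pi> N (output_label A N))"
  proof (rule exI[of _ B], rule exI[of _ bits], rule exI[of _ rounds],
      intro conjI A(1,2) allI impI)
    fix N assume N: "valid_network (arity \<Pi>) c N"
    have "send B (initial_knowledge N v) (history B N t v) p =
        (if t < rounds (card (verts N)) then send A (initial_knowledge N v) (history A N t v) p else [])"
      for t v p
      using hist[of t N v] by (simp add: B_def)
    then show "message_size_bounded B N (bits (card (verts N)))"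
      using A(3)[OF N] by (auto simp: message_size_bounded_def)
    show "terminates_within B N (rounds (card (verts N)))"
      using out[OF N] by (auto simp: terminates_within_def)
    have "output_label B N v = lab N v" if "v \<in> verts N" for v
    proof -
      have "(LEAST t. out_after B N t v \<noteq> None) = rounds (card (verts N))"
        by (rule Least_equality) (use out[OF N that] in \<open>auto split: if_splits\<close>)
      then show ?thesis using out[OF N that] by (simp add: output_label_def)
    qed
    then have "map (output_label B N) vs = map (lab N) vs" if "set vs \<subseteq> verts N" for vs
      using that by auto
    moreover have "children N v \<subseteq> verts N" for v by (auto simp: children_def)
    ultimately show "solution \<Pi> N (output_label B N)"
      using lab(2)[OF N] \<open>\<And>v. v \<in> verts N \<Longrightarrow> output_label B N v = lab N v\<close>
      unfolding solution_def by metis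
  qed
qed

section \<open>Synchronous iterations with typed messages\<close>

primrec local_iter ::
  "(knowledge \<Rightarrow> 'b \<Rightarrow> 's) \<Rightarrow> (knowledge \<Rightarrow> 'b \<Rightarrow> 's \<Rightarrow> 'm list \<Rightarrow> 's) \<Rightarrow>
   (knowledge \<Rightarrow> 'b \<Rightarrow> 's \<Rightarrow> nat \<Rightarrow> 'm) \<Rightarrow> (network \<Rightarrow> nat \<Rightarrow> 'b) \<Rightarrow>
   network \<Rightarrow> nat \<Rightarrow> nat \<Rightarrow> 's" where
  "local_iter F0 F msg f N 0 v = F0 (initial_knowledge N v) (f N v)"
| "local_iter F0 F msg f N (Suc t) v =
     F (initial_knowledge N v) (f N v) (local_iter F0 F msg f N t v)
       (map (\<lambda>w. msg (initial_knowledge N w) (f N w) (local_iter F0 F msg f N t w) (port_to N w v))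
         (ports N v))"

lemma message_encoding:
  fixes S :: "'m set"
  assumes "finite S" "card S \<le> 2 ^ b"
  shows "\<exists>enc :: 'm \<Rightarrow> bool list. inj_on enc S \<and> (\<forall>x\<in>S. length (enc x) = b)"
proof -
  have "card {xs. set xs \<subseteq> (UNIV :: bool set) \<and> length xs = b} = 2 ^ b"
    by (subst card_lists_length_eq) (simp_all add: card_UNIV_bool)
  moreover have "finite {xs. set xs \<subseteq> (UNIV :: bool set) \<and> length xs = b}"
    by (rule finite_lists_length_eq) simp
  ultimately show ?thesis
    using card_le_inj[OF assms(1)] assms(2) by fastforce
qed

text \<open>The two stages run one after the other. A node recovers the result of the first stage
  from the initial part of its history, and the state of the iteration by folding \<open>F\<close>
  over the rest. Only messages are encoded, as words of \<open>b n\<close> bits; states are local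
  and may be of any size.\<close>

theorem congest_computable_iter:
  fixes S :: "nat \<Rightarrow> 'm set" and F0 :: "knowledge \<Rightarrow> 'b \<Rightarrow> 's"
    and F :: "knowledge \<Rightarrow> 'b \<Rightarrow> 's \<Rightarrow> 'm list \<Rightarrow> 's"
  assumes f: "congest_computable d c f"
    and S: "\<And>n. finite (S n)" "\<And>n. card (S n) \<le> 2 ^ b n"
    and b: "(\<lambda>n. real (b n)) \<in> O(\<lambda>n. ln (real n))"
    and r: "(\<lambda>n. real (r n)) \<in> O(\<lambda>n. ln (real n))"
    and msg: "\<And>N v t p. valid_network d c N \<Longrightarrow> v \<in> verts N \<Longrightarrow>
      msg (initial_knowledge N v) (f N v) (local_iter F0 F msg f N t v) p \<in> S (card (verts N))"
  shows "congest_computable d c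
    (\<lambda>N v. (f N v, local_iter F0 F msg f N (r (card (verts N))) v))"
proof -
  from f obtain A :: "'b algorithm" and bits rounds where A:
    "(\<lambda>n. real (bits n)) \<in> O(\<lambda>n. ln (real n))" "(\<lambda>n. real (rounds n)) \<in> O(\<lambda>n. ln (real n))"
    "\<And>N v. valid_network d c N \<Longrightarrow> v \<in> verts N \<Longrightarrow>
      (\<forall>t < rounds (card (verts N)). \<forall>p < deg N v.
         length (send A (initial_knowledge N v) (history A N t v) p) \<le> bits (card (verts N))) \<and>
      out_after A N (rounds (card (verts N))) v = Some (f N v)"
    unfolding congest_computable_def by blast
  have "\<forall>n. \<exists>enc :: 'm \<Rightarrow> bool list. inj_on enc (S n) \<and> (\<forall>x\<in>S n. length (enc x) = b n)"
    using message_encoding[OF S] by blast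
  then obtain enc :: "nat \<Rightarrow> 'm \<Rightarrow> bool list"
    where enc: "\<And>n. inj_on (enc n) (S n)" "\<And>n x. x \<in> S n \<Longrightarrow> length (enc n x) = b n"
    by metis
  define fv where "fv = (\<lambda>k hs. the (out A k (take (rounds (num_nodes k)) hs)))"
  define st where "st = (\<lambda>k hs.
    foldl (\<lambda>s ms. F k (fv k hs) s (map (inv_into (S (num_nodes k)) (enc (num_nodes k))) ms))
      (F0 k (fv k hs)) (drop (rounds (num_nodes k)) hs))"
  define B where "B = \<lparr>
    send = \<lambda>k hs p. if length hs < rounds (num_nodes k) then send A k hs p
      else enc (num_nodes k) (msg k (fv k hs) (st k hs) p),
    out = \<lambda>k hs. Some (fv k hs, st k hs)\<rparr>"
  have phase1: "history B N t v = history A N t v" if "t \<le> rounds (card (verts N))" for N t v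
    using that by (induction t arbitrary: v) (simp_all add: B_def)
  have take_hist: "take (rounds (card (verts N))) (history B N (rounds (card (verts N)) + t) v) =
      history A N (rounds (card (verts N))) v" for N t v
    by (induction t) (simp_all add: phase1)
  have fv: "fv (initial_knowledge N v) (history B N (rounds (card (verts N)) + t) v) = f N v"
    if "valid_network d c N" "v \<in> verts N" for N t v
    using A(3)[OF that] by (simp add: fv_def take_hist out_after_def)
  have st: "st (initial_knowledge N v) (history B N (rounds (card (verts N)) + t) v) =
      local_iter F0 F msg f N t v"
    if N: "valid_network d c N" and "v \<in> verts N" for N t v
    using that(2)
  proof (induction t arbitrary: v)
    case 0
    then show ?case using fv[OF N 0, of 0] by (simp add: st_def)
  next
    case (Suc t)
    let ?r = "rounds (card (verts N))" and ?S = "S (card (verts N))" and ?enc = "enc (card (verts N))"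
    let ?m = "\<lambda>w. msg (initial_knowledge N w) (f N w) (local_iter F0 F msg f N t w) (port_to N w v)"
    have "send B (initial_knowledge N w) (history B N (?r + t) w) (port_to N w v) = ?enc (?m w)"
      and "?m w \<in> ?S" if "w \<in> set (ports N v)" for w
    proof -
      have w: "w \<in> verts N"
        using that N Suc.prems neighbours_in_verts set_ports by blast
      show "send B (initial_knowledge N w) (history B N (?r + t) w) (port_to N w v) = ?enc (?m w)"
        using fv[OF N w, of t] Suc.IH[OF w] by (simp add: B_def)
      show "?m w \<in> ?S" by (rule msg[OF N w])
    qed
    then have "map (inv_into ?S ?enc \<circ> (\<lambda>w. send B (initial_knowledge N w)
        (history B N (?r + t) w) (port_to N w v))) (ports N v) = map ?m (ports N v)"
      using inv_into_f_f[OF enc(1)] by simp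
    then have dec: "map (inv_into ?S ?enc) (map (\<lambda>w. send B (initial_knowledge N w)
        (history B N (?r + t) w) (port_to N w v)) (ports N v)) = map ?m (ports N v)"
      by simp
    have step: "history B N (?r + Suc t) v = history B N (?r + t) v @
        [map (\<lambda>w. send B (initial_knowledge N w) (history B N (?r + t) w) (port_to N w v)) (ports N v)]"
      by simp
    have IH: "foldl (\<lambda>s ms. F (initial_knowledge N v) (f N v) s (map (inv_into ?S ?enc) ms))
        (F0 (initial_knowledge N v) (f N v)) (drop ?r (history B N (?r + t) v)) =
        local_iter F0 F msg f N t v"
      using Suc.IH[OF Suc.prems] fv[OF N Suc.prems, of t] by (simp add: st_def)
    show ?case
      unfolding st_def fv[OF N Suc.prems] num_nodes_initial unfolding step
      by (simp add: IH dec del: map_map)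
  qed
  define bits' where "bits' = (\<lambda>n. bits n + b n)"
  define rounds' where "rounds' = (\<lambda>n. rounds n + r n)"
  have "(\<lambda>n. real (bits' n)) \<in> O(\<lambda>n. ln (real n))"
    using sum_in_bigo(1)[OF A(1) b] by (simp add: bits'_def)
  moreover have "(\<lambda>n. real (rounds' n)) \<in> O(\<lambda>n. ln (real n))"
    using sum_in_bigo(1)[OF A(2) r] by (simp add: rounds'_def)
  moreover have "length (send B (initial_knowledge N v) (history B N t v) p) \<le> bits' (card (verts N))"
    if N: "valid_network d c N" "v \<in> verts N" and "p < deg N v" for N v t p
  proof (cases "t < rounds (card (verts N))")
    case True
    then show ?thesis using A(3)[OF N] phase1[of t N v] that(3)
      by (auto simp: B_def bits'_def intro: trans_le_add1)
  next
    case False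
    then obtain t' where t': "t = rounds (card (verts N)) + t'" by (metis le_Suc_ex not_less)
    show ?thesis using fv[OF N, of t'] st[OF N, of t'] enc(2)[OF msg[OF N, of t']]
      by (simp add: B_def t' bits'_def)
  qed
  moreover have "out_after B N (rounds' (card (verts N))) v =
      Some (f N v, local_iter F0 F msg f N (r (card (verts N))) v)"
    if "valid_network d c N" "v \<in> verts N" for N v
    using fv[OF that] st[OF that] by (simp add: out_after_def rounds'_def B_def)
  ultimately show ?thesis unfolding congest_computable_def by blast
qed

text \<open>An entry determined by entries of smaller rank is settled after more rounds than its
  rank, whatever the initial state. This turns a long enough iteration into a solution of its
  fixed-point equation.\<close>

lemma ranked_iteration_stable:
  fixes g :: "nat \<Rightarrow> 'x \<Rightarrow> 'y" and rank :: "'x \<Rightarrow> nat"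
  assumes "\<And>t t' x. x \<in> X \<Longrightarrow> (\<And>y. y \<in> X \<Longrightarrow> rank y < rank x \<Longrightarrow> g t y = g t' y) \<Longrightarrow>
      g (Suc t) x = g (Suc t') x"
    and "x \<in> X" "rank x < t"
  shows "g (Suc t) x = g t x"
  using assms(2,3)
proof (induction t arbitrary: x)
  case (Suc t)
  show ?case
    by (rule assms(1)[OF Suc.prems(1)]) (use Suc in auto)
qed simp

section \<open>Sparse cut nodes and clusters of bounded depth\<close>

section \<open>Cut nodes\<close>

text \<open>At the root \<open>parent\<close> is meaningless; letting \<open>up\<close> fix the root
  makes the sequence of ancestors constant from there on.\<close>

definition up :: "network \<Rightarrow> nat \<Rightarrow> nat" where
  "up N v = (if v = root N then root N else parent N v)"

lemma up_root [simp]: "up N (root N) = root N"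
  by (simp add: up_def)

lemma up_nonroot: "v \<noteq> root N \<Longrightarrow> up N v = parent N v"
  by (simp add: up_def)

definition depth :: "network \<Rightarrow> nat \<Rightarrow> nat" where
  "depth N v = (LEAST k. (up N ^^ k) v = root N)"

locale tree_network =
  fixes d c :: nat and N :: network
  assumes valid: "valid_network d c N"
begin

lemma tree: "finite (verts N)" "root N \<in> verts N"
  "\<And>v. v \<in> verts N \<Longrightarrow> v \<noteq> root N \<Longrightarrow> parent N v \<in> verts N"
  "\<And>v. v \<in> verts N \<Longrightarrow> \<exists>k. (parent N ^^ k) v = root N"
  using valid by (auto simp: valid_network_def full_tree_def rooted_tree_def)

lemma up_in_verts: "v \<in> verts N \<Longrightarrow> up N v \<in> verts N"
  using tree by (cases "v = root N") (simp_all add: up_nonroot)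

lemma funpow_up_in_verts: "v \<in> verts N \<Longrightarrow> (up N ^^ i) v \<in> verts N"
  by (induction i) (auto simp: up_in_verts)

lemma funpow_up_root [simp]: "(up N ^^ i) (root N) = root N"
  by (induction i) (auto simp: up_nonroot)

lemma funpow_up_reaches_root:
  assumes "v \<in> verts N" shows "\<exists>k. (up N ^^ k) v = root N"
proof -
  \<comment> \<open>Before the least such \<open>k\<close> the root has not been met, so
    \<open>parent\<close> and \<open>up\<close> take the same steps.\<close>
  define k where "k = (LEAST k. (parent N ^^ k) v = root N)"
  have k: "(parent N ^^ k) v = root N"
    using tree(4)[OF assms] unfolding k_def by (rule LeastI_ex)
  have "(up N ^^ j) v = (parent N ^^ j) v" if "j \<le> k" for j
    using that
  proof (induction j)
    case (Suc j)
    have "j < (LEAST k. (parent N ^^ k) v = root N)" using Suc.prems by (simp add: k_def)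
    then have "(parent N ^^ j) v \<noteq> root N" by (rule not_less_Least)
    moreover have "(up N ^^ j) v = (parent N ^^ j) v" using Suc by simp
    ultimately show ?case by (simp add: up_nonroot)
  qed simp
  from this[of k] k show ?thesis by (intro exI[of _ k]) simp
qed

lemma funpow_up_depth: "v \<in> verts N \<Longrightarrow> (up N ^^ depth N v) v = root N"
  unfolding depth_def by (rule LeastI_ex) (rule funpow_up_reaches_root)

lemma depth_eq_0_iff: "v \<in> verts N \<Longrightarrow> depth N v = 0 \<longleftrightarrow> v = root N"
  using funpow_up_depth[of v] by (auto simp: depth_def)

lemma depth_up:
  assumes "v \<in> verts N" "v \<noteq> root N" shows "depth N v = Suc (depth N (up N v))"
proof -
  have "(LEAST k. (up N ^^ k) v = root N) = Suc (LEAST k. (up N ^^ Suc k) v = root N)"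
    by (rule Least_Suc, rule funpow_up_depth[OF assms(1)]) (use assms in simp)
  then show ?thesis by (simp add: depth_def funpow_swap1)
qed

lemma depth_funpow_up: "v \<in> verts N \<Longrightarrow> depth N ((up N ^^ i) v) = depth N v - i"
proof (induction i)
  case (Suc i)
  let ?w = "(up N ^^ i) v"
  have "depth N (up N ?w) = depth N ?w - 1"
  proof (cases "?w = root N")
    case True
    then show ?thesis using depth_eq_0_iff[OF tree(2)] by (simp add: up_nonroot)
  qed (use depth_up funpow_up_in_verts[OF Suc.prems] in simp)
  then show ?case using Suc by simp
qed simp

lemma funpow_up_neq:
  assumes "v \<in> verts N" "i < depth N v" "i < j"
  shows "(up N ^^ i) v \<noteq> (up N ^^ j) v"
proof
  assume "(up N ^^ i) v = (up N ^^ j) v"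
  then have "depth N ((up N ^^ i) v) = depth N ((up N ^^ j) v)" by simp
  then have "depth N v - i = depth N v - j" by (simp only: depth_funpow_up[OF assms(1)])
  then show False using assms(2,3) by simp
qed

lemma children_iff: "w \<in> children N v \<longleftrightarrow> w \<in> verts N \<and> w \<noteq> root N \<and> up N w = v"
  by (auto simp: children_def up_nonroot)

lemma finite_children: "finite (children N v)"
  using tree(1) by (simp add: children_def)

lemma parent_port_initial:
  "parent_port (initial_knowledge N v) =
    (if v = root N then None else Some (port_to N v (parent N v)))"
  by (simp add: initial_knowledge_def)

lemma parent_message:
  assumes "v \<in> verts N" "v \<noteq> root N"
  shows "map g (ports N v) ! port_to N v (parent N v) = g (up N v)"
proof -
  have "parent N v \<in> neighbours N v" using assms by (simp add: neighbours_def)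
  from port_to[OF valid assms(1) this] show ?thesis
    using length_ports[OF valid assms(1)] assms(2) by (simp add: up_nonroot)
qed

lemma parent_port_eq_iff_child:
  assumes "v \<in> verts N" "w \<in> neighbours N v"
  shows "parent_port (initial_knowledge N w) = Some (port_to N w v) \<longleftrightarrow> w \<in> children N v"
proof -
  have w: "w \<in> verts N" using neighbours_in_verts[OF valid assms] .
  have v: "v \<in> neighbours N w" using neighbours_sym[OF valid assms] .
  show ?thesis
  proof (cases "w = root N")
    case False
    then have "parent N w \<in> neighbours N w" by (simp add: neighbours_def)
    have "port_to N w (parent N w) = port_to N w v \<longleftrightarrow> parent N w = v"
    proof
      assume "port_to N w (parent N w) = port_to N w v"
      then have "ports N w ! port_to N w (parent N w) = ports N w ! port_to N w v"
        by (rule arg_cong)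
      then show "parent N w = v"
        unfolding port_to(2)[OF valid w \<open>parent N w \<in> neighbours N w\<close>] port_to(2)[OF valid w v] .
    qed simp
    then show ?thesis using False w by (simp add: parent_port_initial children_def)
  qed (simp add: parent_port_initial children_def)
qed

lemma ident_bounds:
  assumes "v \<in> verts N" shows "ident N v \<in> {1..card (verts N) ^ c}"
  using valid assms by (auto simp: valid_network_def)

lemma ident_eq_iff: "v \<in> verts N \<Longrightarrow> w \<in> verts N \<Longrightarrow> ident N v = ident N w \<longleftrightarrow> v = w"
  using valid by (auto simp: valid_network_def inj_on_eq_iff)

end

text \<open>Identifiers are at most \<open>n ^ c\<close>, so \<open>floorlog 2 n * c\<close> rounds
  of losing one bit each bring the colours down to 3 bits. The root is included so that every node
  has a cut node at or above it.\<close>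

definition cut_node :: "nat \<Rightarrow> nat \<Rightarrow> network \<Rightarrow> nat \<Rightarrow> bool" where
  "cut_node m c N v \<longleftrightarrow> v = root N \<or>
     marked m (floorlog 2 (card (verts N)) * c) (\<lambda>i. ident N ((up N ^^ i) v))"

text \<open>The path length required by \<open>marked_exists\<close>; it bounds the distance up to
  the next cut node independently of \<open>n\<close>.\<close>

definition cut_gap :: "nat \<Rightarrow> nat" where
  "cut_gap m = 2 * m * 8 ^ m + 2 * m"

definition cut_dist :: "nat \<Rightarrow> nat \<Rightarrow> network \<Rightarrow> nat \<Rightarrow> nat" where
  "cut_dist m c N v = (LEAST i. cut_node m c N ((up N ^^ i) v))"

definition cluster :: "nat \<Rightarrow> nat \<Rightarrow> network \<Rightarrow> nat \<Rightarrow> nat" where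
  "cluster m c N v = (up N ^^ cut_dist m c N v) v"

lemma power_le_two_power: "n ^ c \<le> 2 ^ (floorlog 2 n * c)"
proof -
  have "n ^ c \<le> (2 ^ floorlog 2 n) ^ c"
    using less_two_power_floorlog[of n] by (simp add: power_mono)
  then show ?thesis by (simp add: power_mult)
qed

locale cut_network = tree_network +
  fixes m :: nat
  assumes m_pos: "m \<ge> 1"
begin

abbreviation "is_cut \<equiv> cut_node m c N"
abbreviation "dist_cut \<equiv> cut_dist m c N"
abbreviation "cl \<equiv> cluster m c N"

lemma cut_root [simp]: "is_cut (root N)" by (simp add: cut_node_def)

text \<open>Either the root is within reach, or the identifiers on the way up are distinct far
  enough for \<open>marked_exists\<close>.\<close>

lemma cut_exists:
  assumes "v \<in> verts N" shows "\<exists>i \<le> cut_gap m. is_cut ((up N ^^ i) v)"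
proof (cases "depth N v \<le> cut_gap m")
  case True
  then show ?thesis using funpow_up_depth[OF assms] by (intro exI[of _ "depth N v"]) simp
next
  case False
  let ?x = "\<lambda>i. ident N ((up N ^^ i) v)" and ?r = "floorlog 2 (card (verts N)) * c"
  have "\<exists>i\<le>cut_gap m. marked m ?r (\<lambda>k. ?x (k + i))"
  proof (rule marked_exists[OF m_pos])
    fix i
    have "?x i \<le> card (verts N) ^ c"
      using ident_bounds[OF funpow_up_in_verts[OF assms]] by simp
    also have "\<dots> \<le> 2 ^ ?r" by (rule power_le_two_power)
    also have "(2::nat) ^ ?r < 2 ^ (3 + ?r)" by simp
    finally show "?x i < 2 ^ (3 + ?r)" .
  next
    fix i j assume "i < cut_gap m" "i < j"
    then show "?x i \<noteq> ?x j"
      using funpow_up_neq[OF assms, of i j] False ident_eq_iff funpow_up_in_verts[OF assms] by simp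
  qed (simp add: cut_gap_def)
  then show ?thesis by (auto simp: cut_node_def funpow_add)
qed

text \<open>Marked ancestors are handled by \<open>marked_spaced\<close>. For the root, the
  identifier condition in \<open>marked\<close> forces \<open>v\<close> to have depth at least
  \<open>2 * m\<close>.\<close>

lemma cut_spaced:
  assumes "v \<in> verts N" "v \<noteq> root N" "is_cut v" "is_cut ((up N ^^ i) v)" "i \<ge> 1"
  shows "m \<le> i"
proof -
  let ?x = "\<lambda>i. ident N ((up N ^^ i) v)" and ?r = "floorlog 2 (card (verts N)) * c"
  have v: "marked m ?r (\<lambda>k. ?x (k + 0))" using assms by (simp add: cut_node_def)
  show ?thesis
  proof (cases "(up N ^^ i) v = root N")
    case True
    have "?x (2 * m - 1) \<noteq> ?x (2 * m)" using v by (simp add: marked_def)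
    moreover have "(up N ^^ Suc (2 * m - 1)) v = (up N ^^ (2 * m)) v" using m_pos by simp
    ultimately have "(up N ^^ (2 * m - 1)) v \<noteq> root N" by (auto simp: up_nonroot)
    moreover have "(up N ^^ (2 * m - 1)) v = root N" if "i \<le> 2 * m - 1"
    proof -
      have "(up N ^^ (2 * m - 1 - i + i)) v = root N" unfolding funpow_add o_apply True by simp
      then show ?thesis unfolding le_add_diff_inverse2[OF that] .
    qed
    ultimately show ?thesis using m_pos by linarith
  next
    case False
    then have "marked m ?r (\<lambda>k. ?x (k + i))" using assms(4) by (simp add: cut_node_def funpow_add)
    from marked_spaced[OF v this] show ?thesis using assms(5) by simp
  qed
qed

lemma cut_dist_le: "v \<in> verts N \<Longrightarrow> dist_cut v \<le> cut_gap m"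
proof -
  assume "v \<in> verts N"
  then obtain i where i: "i \<le> cut_gap m" "is_cut ((up N ^^ i) v)" using cut_exists by blast
  have "dist_cut v \<le> i" unfolding cut_dist_def by (rule Least_le) (rule i(2))
  then show ?thesis using i(1) by simp
qed

lemma cut_cluster: "v \<in> verts N \<Longrightarrow> is_cut (cl v)"
proof -
  assume "v \<in> verts N"
  then obtain i where "is_cut ((up N ^^ i) v)" using cut_exists by blast
  then show ?thesis unfolding cut_dist_def cluster_def by (rule LeastI)
qed

lemma cut_dist_eq_0: "is_cut v \<Longrightarrow> dist_cut v = 0"
  by (simp add: cut_dist_def)

lemma cut_dist_up:
  assumes "v \<in> verts N" "\<not> is_cut v" shows "dist_cut v = Suc (dist_cut (up N v))"
proof -
  obtain i where i: "is_cut ((up N ^^ i) v)" using cut_exists[OF assms(1)] by blast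
  have "(LEAST k. is_cut ((up N ^^ k) v)) = Suc (LEAST k. is_cut ((up N ^^ Suc k) v))"
    by (rule Least_Suc, rule i) (use assms in simp)
  then show ?thesis by (simp add: cut_dist_def funpow_swap1)
qed

lemma cluster_cut: "is_cut v \<Longrightarrow> cl v = v"
  by (simp add: cluster_def cut_dist_eq_0)

lemma cluster_up:
  assumes "v \<in> verts N" "\<not> is_cut v" shows "cl (up N v) = cl v"
  by (simp add: cluster_def cut_dist_up[OF assms] funpow_swap1)

lemma cluster_in_verts: "v \<in> verts N \<Longrightarrow> cl v \<in> verts N"
  by (simp add: cluster_def funpow_up_in_verts)

end

text \<open>In every round a node receives the topmost identifier known to its parent, so one
  identifier per message teaches it one more ancestor per round.\<close>

theorem cut_node_computable: "congest_computable d c (cut_node m c)"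
proof -
  define F0 where "F0 = (\<lambda>(k::knowledge) (u::bool). [own_id k])"
  \<comment> \<open>At the root the last entry is repeated, in accordance with the constant tail of
    the ancestor sequence.\<close>
  define F where "F = (\<lambda>(k::knowledge) (u::bool) s ms.
    s @ [case parent_port k of None \<Rightarrow> last s | Some p \<Rightarrow> (ms ! p :: nat)])"
  define msg where "msg = (\<lambda>(k::knowledge) (u::bool) (s::nat list) (p::nat). last s)"
  define f where "f = (\<lambda>(N::network) (v::nat). True)"
  define r where "r = (\<lambda>n. m * c * floorlog 2 n + 2 * m)"
  have F: "F k u s ms = s @ [case parent_port k of None \<Rightarrow> last s | Some p \<Rightarrow> ms ! p]"
    and msg: "msg k u s p = last s" for k u s ms p
    by (simp_all add: F_def msg_def)
  have list: "local_iter F0 F msg f N t v = map (\<lambda>i. ident N ((up N ^^ i) v)) [0..<Suc t]"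
    if "valid_network d c N" "v \<in> verts N" for N t v
  proof -
    interpret tree_network d c N by standard (rule that)
    show ?thesis using that(2)
    proof (induction t arbitrary: v)
      case 0
      then show ?case by (simp add: F0_def initial_knowledge_def)
    next
      case (Suc t)
      have last: "last (local_iter F0 F msg f N t w) = ident N ((up N ^^ t) w)"
        if "w \<in> verts N" for w
        using Suc.IH[OF that] by simp
      have "local_iter F0 F msg f N (Suc t) v =
          local_iter F0 F msg f N t v @ [ident N ((up N ^^ t) (up N v))]"
      proof (cases "v = root N")
        case True
        then show ?thesis using last[OF Suc.prems] by (simp add: F parent_port_initial)
      next
        case False
        then show ?thesis using last[OF up_in_verts[OF Suc.prems]]
          by (simp add: F parent_port_initial msg
              parent_message[OF Suc.prems False, of "\<lambda>w. last (local_iter F0 F msg f N t w)"]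
              del: nth_map)
      qed
      also have "(up N ^^ t) (up N v) = (up N ^^ Suc t) v" by (simp only: funpow_Suc_right o_apply)
      finally show ?case using Suc.IH[OF Suc.prems]
        by (simp only: upt_Suc_append[of 0 "Suc t"] map_append list.map le0)
    qed
  qed
  have "congest_computable d c (\<lambda>N v. (f N v, local_iter F0 F msg f N (r (card (verts N))) v))"
  proof (rule congest_computable_iter)
    show "congest_computable d c f" unfolding f_def by (rule congest_computable_const)
    show "finite {1..n ^ c}" for n :: nat by simp
    show "card {1..n ^ c} \<le> 2 ^ (c * floorlog 2 n + 0)" for n
      using power_le_two_power[of n c] by (simp add: mult.commute)
    show "(\<lambda>n. real (c * floorlog 2 n + 0)) \<in> O(\<lambda>n. ln (real n))" by (rule log_bits_bigo)
    show "(\<lambda>n. real (r n)) \<in> O(\<lambda>n. ln (real n))" unfolding r_def by (rule log_bits_bigo)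
    fix N v t p assume Nv: "valid_network d c N" "v \<in> verts N"
    interpret tree_network d c N by standard (rule Nv)
    show "msg (initial_knowledge N v) (f N v) (local_iter F0 F msg f N t v) p
        \<in> {1..card (verts N) ^ c}"
      using ident_bounds[OF funpow_up_in_verts[OF Nv(2)]] by (simp add: msg list[OF Nv])
  qed
  from congest_computable_map[OF this, of "\<lambda>k y. parent_port k = None \<or>
      marked m (floorlog 2 (num_nodes k) * c) (\<lambda>i. snd y ! i)"]
  have comp: "congest_computable d c (\<lambda>N v. parent_port (initial_knowledge N v) = None \<or>
      marked m (floorlog 2 (card (verts N)) * c)
        (\<lambda>i. local_iter F0 F msg f N (r (card (verts N))) v ! i))"
    by simp
  have eq: "(parent_port (initial_knowledge N v) = None \<or>
      marked m (floorlog 2 (card (verts N)) * c)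
        (\<lambda>i. local_iter F0 F msg f N (r (card (verts N))) v ! i)) = cut_node m c N v"
    if Nv: "valid_network d c N" "v \<in> verts N" for N v
  proof -
    have "marked m (floorlog 2 (card (verts N)) * c)
          (\<lambda>i. local_iter F0 F msg f N (r (card (verts N))) v ! i) =
        marked m (floorlog 2 (card (verts N)) * c) (\<lambda>i. ident N ((up N ^^ i) v))"
    proof (rule marked_cong)
      fix i assume "i \<le> floorlog 2 (card (verts N)) * c * m + 2 * m"
      then have "i < Suc (r (card (verts N)))" by (simp add: r_def mult_ac)
      then show "local_iter F0 F msg f N (r (card (verts N))) v ! i = ident N ((up N ^^ i) v)"
        unfolding list[OF Nv] by (subst nth_map) (auto simp del: upt_Suc)
    qed
    then show ?thesis by (simp add: cut_node_def initial_knowledge_def)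
  qed
  show ?thesis using comp by (rule congest_computable_cong) (use eq in blast)
qed

section \<open>Logarithmically many cluster levels\<close>

section \<open>Levels of clusters\<close>

text \<open>\<open>count_level\<close> is the number, capped at 2, of cluster roots of level \<open>t\<close> that are below a
  node and not separated from it by another cut node.  The lists contain what was received
  through the ports, where a parent sends the zero function.\<close>

definition count_level :: "(nat \<Rightarrow> nat) list \<Rightarrow> nat \<Rightarrow> nat" where
  "count_level ms t = min 2 (\<Sum>x\<leftarrow>ms. x t)"

text \<open>A cut node turns counts into indicators: its cluster is always on level 0, and on level
  \<open>t\<close> if two cluster roots of level \<open>t - 1\<close> were counted. Other nodes pass
  the counts on. The bound \<open>L\<close> leaves finitely many possible messages.\<close>

definition level_msg :: "nat \<Rightarrow> bool \<Rightarrow> (nat \<Rightarrow> nat) list \<Rightarrow> nat \<Rightarrow> nat" where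
  "level_msg L b ms t = (if t \<le> L then
     if b then if t = 0 \<or> count_level ms (t - 1) \<ge> 2 then 1 else 0 else count_level ms t
   else 0)"

lemma level_msg_cong:
  assumes "\<And>t. t \<le> L \<Longrightarrow> count_level ms t = count_level ms' t"
  shows "level_msg L b ms = level_msg L b ms'"
  using assms by (auto simp: level_msg_def fun_eq_iff)

lemma level_msg_bounds: "level_msg L b ms t \<le> 2" "t > L \<Longrightarrow> level_msg L b ms t = 0"
  by (auto simp: level_msg_def count_level_def)

definition level_messages :: "nat \<Rightarrow> (nat \<Rightarrow> nat) set" where
  "level_messages L = {g. (\<forall>t. g t \<le> 2) \<and> (\<forall>t>L. g t = 0)}"

text \<open>Entries are at most 2, so two bits for each of the \<open>L + 1\<close> levels
  suffice.\<close>

lemma level_messages_card: "finite (level_messages L)" "card (level_messages L) \<le> 2 ^ (2 * L + 2)"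
proof -
  define h where "h = (\<lambda>g :: nat \<Rightarrow> nat. map g [0..<Suc L])"
  let ?B = "{xs. set xs \<subseteq> {0..2::nat} \<and> length xs = Suc L}"
  have inj: "inj_on h (level_messages L)"
  proof (rule inj_onI)
    fix g g' assume g: "g \<in> level_messages L" "g' \<in> level_messages L" "h g = h g'"
    then have "\<forall>t \<in> set [0..<Suc L]. g t = g' t" unfolding h_def by (simp only: map_eq_conv)
    then have "g t = g' t" for t
      using g(1,2) by (cases "t \<le> L") (auto simp: level_messages_def)
    then show "g = g'" by blast
  qed
  have sub: "h ` level_messages L \<subseteq> ?B"
    by (auto simp: h_def level_messages_def simp del: upt_Suc)
  have fin: "finite ?B" by (rule finite_lists_length_eq) simp
  show "finite (level_messages L)" using inj_on_finite[OF inj sub fin] .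
  have "card (level_messages L) \<le> card ?B" using card_inj_on_le[OF inj sub fin] .
  also have "card ?B = 3 ^ Suc L" by (subst card_lists_length_eq) simp_all
  also have "\<dots> \<le> 4 ^ Suc L" by (rule power_mono) simp_all
  also have "(4::nat) ^ Suc L = (2 ^ 2) ^ Suc L" by simp
  also have "\<dots> = 2 ^ (2 * L + 2)" unfolding power_mult[symmetric] by simp
  finally show "card (level_messages L) \<le> 2 ^ (2 * L + 2)" .
qed

context tree_network begin

lemma sum_ports_children:
  assumes "v \<in> verts N"
  shows "(\<Sum>x\<leftarrow>map (\<lambda>w. if w \<in> children N v then h w else (\<lambda>_. 0)) (ports N v). x t) =
    (\<Sum>w\<in>children N v. (h w t :: nat))"
proof -
  have dist: "distinct (ports N v)" and set: "set (ports N v) = neighbours N v"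
    using valid assms by (auto simp: valid_network_def)
  have "(\<Sum>x\<leftarrow>map (\<lambda>w. if w \<in> children N v then h w else (\<lambda>_. 0)) (ports N v). x t) =
      (\<Sum>w\<leftarrow>ports N v. if w \<in> children N v then h w t else 0)"
    by (auto simp: o_def intro!: arg_cong[of _ _ sum_list])
  also have "\<dots> = (\<Sum>w\<in>neighbours N v. if w \<in> children N v then h w t else 0)"
    using dist set by (simp add: sum_list_distinct_conv_sum_set)
  also have "\<dots> = (\<Sum>w\<in>children N v. h w t)"
    by (rule sum.mono_neutral_cong_right) (auto simp: neighbours_def finite_children)
  finally show ?thesis .
qed

end

text \<open>The count at level \<open>t\<close> depends on counts at level \<open>t\<close> deeper
  in the same cluster and at level \<open>t - 1\<close> in child clusters. As clusters have bounded
  depth, logarithmically many rounds reach the fixed point.\<close>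

theorem levels_computable:
  assumes "m \<ge> 1"
  shows "\<exists>ms. congest_computable d c (\<lambda>N v. (cut_node m c N v, ms N v)) \<and>
    (\<forall>N v. valid_network d c N \<longrightarrow> v \<in> verts N \<longrightarrow>
       ms N v = map (\<lambda>w. if w \<in> children N v
         then level_msg (floorlog 2 (card (verts N))) (cut_node m c N w) (ms N w) else (\<lambda>_. 0))
         (ports N v))"
proof -
  define F0 where "F0 = (\<lambda>(k::knowledge) (b::bool). [] :: (nat \<Rightarrow> nat) list)"
  define F where "F = (\<lambda>(k::knowledge) (b::bool) (s :: (nat \<Rightarrow> nat) list) (ms :: (nat \<Rightarrow> nat) list). ms)"
  define msg where "msg = (\<lambda>(k::knowledge) (b::bool) s p.
    if parent_port k = Some p then level_msg (floorlog 2 (num_nodes k)) b s else (\<lambda>_. 0))"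
  have F: "F k b s ms = ms" and msg: "msg k b s p =
    (if parent_port k = Some p then level_msg (floorlog 2 (num_nodes k)) b s else (\<lambda>_. 0))"
    for k b s ms p by (simp_all add: F_def msg_def)
  let ?D = "cut_gap m"
  define st where "st = local_iter F0 F msg (cut_node m c)"
  define R where "R = (\<lambda>n. (?D + 1) * floorlog 2 n + (?D + 1))"
  define ms where "ms = (\<lambda>N v. st N (Suc (R (card (verts N)))) v)"
  have "congest_computable d c (\<lambda>N v. (cut_node m c N v,
      local_iter F0 F msg (cut_node m c) N (Suc (R (card (verts N)))) v))"
  proof (rule congest_computable_iter)
    show "congest_computable d c (cut_node m c)" by (rule cut_node_computable)
    show "finite (level_messages (floorlog 2 n))" for n by (rule level_messages_card)
    show "card (level_messages (floorlog 2 n)) \<le> 2 ^ (2 * floorlog 2 n + 2)" for n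
      by (rule level_messages_card)
    show "(\<lambda>n. real (2 * floorlog 2 n + 2)) \<in> O(\<lambda>n. ln (real n))" by (rule log_bits_bigo)
    show "(\<lambda>n. real (Suc (R n))) \<in> O(\<lambda>n. ln (real n))"
      using log_bits_bigo[of "?D + 1" "?D + 2"] by (simp add: R_def)
    show "msg (initial_knowledge N v) (cut_node m c N v) (local_iter F0 F msg (cut_node m c) N t v) p
        \<in> level_messages (floorlog 2 (card (verts N)))" for N v t p
      by (auto simp: msg level_messages_def level_msg_bounds)
  qed
  then have comp: "congest_computable d c (\<lambda>N v. (cut_node m c N v, ms N v))"
    by (simp only: ms_def st_def)
  have eq: "ms N v = map (\<lambda>w. if w \<in> children N v
         then level_msg (floorlog 2 (card (verts N))) (cut_node m c N w) (ms N w) else (\<lambda>_. 0))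
         (ports N v)"
    if Nv: "valid_network d c N" "v \<in> verts N" for N v
  proof -
    interpret cut_network d c N m by standard (rule Nv assms)+
    let ?L = "floorlog 2 (card (verts N))"
    have step: "st N (Suc r) v = map (\<lambda>w. if w \<in> children N v
        then level_msg ?L (is_cut w) (st N r w) else (\<lambda>_. 0)) (ports N v)"
      if "v \<in> verts N" for r v
      unfolding st_def local_iter.simps F
      by (rule map_cong[OF refl]) (simp add: msg set_ports[OF valid that] parent_port_eq_iff_child[OF that])
    have cnt: "count_level (st N (Suc r) v) t =
        min 2 (\<Sum>w\<in>children N v. level_msg ?L (is_cut w) (st N r w) t)"
      if "v \<in> verts N" for r v t
      unfolding step[OF that] count_level_def sum_ports_children[OF that] ..
    define g where "g = (\<lambda>r (v, t). count_level (st N r v) t)"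
    have g: "g r (v, t) = count_level (st N r v) t" for r v t by (simp add: g_def)
    \<comment> \<open>Lexicographic: a cut child lowers the level, any other child is farther from
      its cluster root.\<close>
    define rank where "rank = (\<lambda>(v, t). t * (?D + 1) + (?D - dist_cut v))"
    have rank: "rank (v, t) = t * (?D + 1) + (?D - dist_cut v)" for v t by (simp add: rank_def)
    have dep: "g (Suc r) x = g (Suc r') x"
      if x: "x \<in> verts N \<times> {..?L}"
        and IH: "\<And>y. y \<in> verts N \<times> {..?L} \<Longrightarrow> rank y < rank x \<Longrightarrow> g r y = g r' y" for r r' x
    proof -
      obtain v t where vt: "x = (v, t)" "v \<in> verts N" "t \<le> ?L" using x by auto
      have "level_msg ?L (is_cut w) (st N r w) t = level_msg ?L (is_cut w) (st N r' w) t"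
        if "w \<in> children N v" for w
      proof -
        have w: "w \<in> verts N" "up N w = v" using that by (auto simp: children_iff)
        show ?thesis
        proof (cases "is_cut w")
          case True
          show ?thesis
          proof (cases t)
            case (Suc t')
            have "rank (w, t') < rank x"
              unfolding vt(1) rank Suc using cut_dist_eq_0[OF True] by simp
            from IH[OF _ this] have "count_level (st N r w) t' = count_level (st N r' w) t'"
              using w vt(3) Suc by (simp add: g)
            then show ?thesis using True Suc by (simp add: level_msg_def)
          qed (simp add: True level_msg_def)
        next
          case False
          have "rank (w, t) < rank x"
            unfolding vt(1) rank using cut_dist_up[OF w(1) False] cut_dist_le[OF w(1)] w(2) by simp
          from IH[OF _ this] have "count_level (st N r w) t = count_level (st N r' w) t"
            using w vt(3) by (simp add: g)
          then show ?thesis using False by (simp add: level_msg_def)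
        qed
      qed
      then show ?thesis unfolding vt(1) g cnt[OF vt(2)] by simp
    qed
    let ?R = "R (card (verts N))"
    have stable: "count_level (st N (Suc ?R) w) t = count_level (st N ?R w) t"
      if "w \<in> verts N" "t \<le> ?L" for w t
    proof -
      have "t * (?D + 1) \<le> ?L * (?D + 1)" using that(2) by (rule mult_le_mono1)
      then have "rank (w, t) < ?R" unfolding rank R_def by (simp add: mult.commute)
      have "g (Suc ?R) (w, t) = g ?R (w, t)"
      proof (rule ranked_iteration_stable[where X = "verts N \<times> {..?L}" and rank = rank])
        show "(w, t) \<in> verts N \<times> {..?L}" using that by simp
      qed (fact dep, fact)
      then show ?thesis by (simp only: g)
    qed
    \<comment> \<open>Stability of the counts up to \<open>?L\<close> is enough here, since
      \<open>level_msg\<close> reads nothing else.\<close>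
    have "level_msg ?L b (st N ?R w) = level_msg ?L b (ms N w)" if "w \<in> verts N" for b w
      unfolding ms_def by (rule level_msg_cong) (simp add: stable[OF that])
    moreover have "w \<in> verts N" if "w \<in> children N v" for w
      using that by (simp add: children_iff)
    ultimately show ?thesis unfolding ms_def step[OF Nv(2)]
      by (intro map_cong refl) (simp add: ms_def)
  qed
  show ?thesis using comp eq by blast
qed

text \<open>The length of the initial run of positive entries, used as the highest level plus one; 0
  means that no cluster root is reported.\<close>

definition level_of :: "(nat \<Rightarrow> nat) \<Rightarrow> nat" where
  "level_of g = (LEAST t. g t = 0)"

lemma less_level_of: "t < level_of g \<Longrightarrow> g t > 0"
  unfolding level_of_def using not_less_Least by blast

lemma level_of_pos_iff:
  assumes "g t = 0" shows "level_of g > 0 \<longleftrightarrow> g 0 > 0"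
  using less_level_of[of 0 g] LeastI[of "\<lambda>t. g t = 0", OF assms]
  unfolding level_of_def by (metis gr0I less_numeral_extra(3))

lemma level_of_zero [simp]: "level_of (\<lambda>_. 0) = 0"
  by (simp add: level_of_def)

definition has_best :: "(nat \<Rightarrow> nat) list \<Rightarrow> bool" where
  "has_best ms \<longleftrightarrow> (\<exists>x\<in>set ms. level_of x > 0)"

definition best_port :: "(nat \<Rightarrow> nat) list \<Rightarrow> nat" where
  "best_port ms = (SOME p. p < length ms \<and> (\<forall>q<length ms. level_of (ms ! q) \<le> level_of (ms ! p)))"

lemma best_port:
  assumes "has_best ms"
  shows "best_port ms < length ms" "level_of (ms ! best_port ms) > 0"
    "\<And>x. x \<in> set ms \<Longrightarrow> level_of x \<le> level_of (ms ! best_port ms)"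
proof -
  obtain p where p: "p < length ms" "level_of (ms ! p) > 0"
    using assms unfolding has_best_def by (metis in_set_conv_nth)
  have "finite {..<length ms}" "{..<length ms} \<noteq> {}" using p(1) by auto
  from finite_imageI[OF this(1), of "\<lambda>p. level_of (ms ! p)"] this(2)
  have "Max ((\<lambda>p. level_of (ms ! p)) ` {..<length ms}) \<in> (\<lambda>p. level_of (ms ! p)) ` {..<length ms}"
    by (intro Max_in) auto
  then obtain q where q: "q < length ms"
    "level_of (ms ! q) = Max ((\<lambda>p. level_of (ms ! p)) ` {..<length ms})" by auto
  have "level_of (ms ! q') \<le> level_of (ms ! q)" if "q' < length ms" for q'
    unfolding q(2) by (rule Max_ge) (use that in auto)
  with q(1) have "\<exists>p. p < length ms \<and> (\<forall>q<length ms. level_of (ms ! q) \<le> level_of (ms ! p))"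
    by blast
  then have b: "best_port ms < length ms \<and>
      (\<forall>q<length ms. level_of (ms ! q) \<le> level_of (ms ! best_port ms))"
    unfolding best_port_def by (rule someI_ex)
  then show "best_port ms < length ms" by simp
  show "level_of (ms ! best_port ms) > 0" using b p less_le_trans by blast
  show "level_of x \<le> level_of (ms ! best_port ms)" if "x \<in> set ms" for x
    using that b by (auto simp: in_set_conv_nth)
qed

locale level_network = cut_network +
  fixes ms :: "nat \<Rightarrow> (nat \<Rightarrow> nat) list"
  assumes ms_eq: "\<And>v. v \<in> verts N \<Longrightarrow> ms v = map (\<lambda>w. if w \<in> children N v
    then level_msg (floorlog 2 (card (verts N))) (cut_node m c N w) (ms w) else (\<lambda>_. 0)) (ports N v)"
begin

abbreviation "L \<equiv> floorlog 2 (card (verts N))"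
abbreviation "levels w \<equiv> level_msg L (is_cut w) (ms w)"
abbreviation "best v \<equiv> ports N v ! best_port (ms v)"

lemma count_level_eq:
  "v \<in> verts N \<Longrightarrow> count_level (ms v) t = min 2 (\<Sum>w\<in>children N v. levels w t)"
  unfolding count_level_def
  by (subst ms_eq, assumption, subst sum_ports_children, assumption) (rule refl)

section \<open>Counting descendants to bound the levels\<close>

definition descendants :: "nat \<Rightarrow> nat set" where
  "descendants v = {u \<in> verts N. \<exists>i. (up N ^^ i) u = v}"

lemma finite_descendants: "finite (descendants v)"
  using tree(1) by (simp add: descendants_def)

lemma depth_child: "w \<in> children N v \<Longrightarrow> depth N w = Suc (depth N v)"
  using depth_up by (auto simp: children_iff)

lemma descendants_child_subset:
  assumes "v \<in> verts N" "w \<in> children N v" shows "descendants w \<subset> descendants v"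
proof -
  have "descendants w \<subseteq> descendants v"
  proof
    fix u assume "u \<in> descendants w"
    then obtain i where "u \<in> verts N" "(up N ^^ i) u = w" by (auto simp: descendants_def)
    then have "u \<in> verts N" "(up N ^^ Suc i) u = v" using assms(2) by (simp_all add: children_iff)
    then show "u \<in> descendants v" unfolding descendants_def by blast
  qed
  moreover have "v \<in> descendants v"
    unfolding descendants_def using assms(1) by (auto intro: exI[of _ 0])
  moreover have "v \<notin> descendants w"
  proof
    assume "v \<in> descendants w"
    then obtain i where "(up N ^^ i) v = w" by (auto simp: descendants_def)
    then have "depth N w \<le> depth N v" using depth_funpow_up[OF assms(1), of i] by simp
    then show False using depth_child[OF assms(2)] by simp
  qed
  ultimately show ?thesis by blast
qed

lemma sum_card_descendants:
  assumes "v \<in> verts N"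
  shows "(\<Sum>w\<in>children N v. card (descendants w)) \<le> card (descendants v)"
proof -
  have disj: "descendants w \<inter> descendants w' = {}"
    if "w \<in> children N v" "w' \<in> children N v" "w \<noteq> w'" for w w'
  proof (rule ccontr)
    assume "descendants w \<inter> descendants w' \<noteq> {}"
    then obtain u i j where u: "u \<in> verts N" "(up N ^^ i) u = w" "(up N ^^ j) u = w'"
      by (auto simp: descendants_def)
    have "depth N u - i = Suc (depth N v)" "depth N u - j = Suc (depth N v)"
      using depth_funpow_up[OF u(1), of i] depth_funpow_up[OF u(1), of j] u(2,3)
        depth_child[OF that(1)] depth_child[OF that(2)] by simp_all
    then have "i = j" by linarith
    then show False using u(2,3) that(3) by simp
  qed
  have "(\<Sum>w\<in>children N v. card (descendants w)) = card (\<Union>w\<in>children N v. descendants w)"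
    by (rule card_UN_disjoint[symmetric]) (use finite_children finite_descendants disj in auto)
  also have "\<dots> \<le> card (descendants v)"
    by (rule card_mono[OF finite_descendants]) (use descendants_child_subset[OF assms] in blast)
  finally show ?thesis .
qed

text \<open>A cluster root on level \<open>t\<close> has at least \<open>2 ^ t\<close> descendants:
  for \<open>t > 0\<close> it has below it two cluster roots of level \<open>t - 1\<close> with
  disjoint sets of descendants.\<close>

lemma count_level_descendants:
  "v \<in> verts N \<Longrightarrow> 2 ^ t * count_level (ms v) t \<le> card (descendants v)"
proof (induction "card (descendants v)" arbitrary: v t rule: less_induct)
  case less
  have child: "2 ^ t * levels w t \<le> card (descendants w)" if w: "w \<in> children N v" for w
  proof -
    have wV: "w \<in> verts N" using w by (simp add: children_iff)
    have IH: "2 ^ t' * count_level (ms w) t' \<le> card (descendants w)" for t'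
      using less.hyps[OF psubset_card_mono[OF finite_descendants
          descendants_child_subset[OF less.prems w]] wV] .
    show ?thesis
    proof (cases "t \<le> L \<and> is_cut w")
      case True
      show ?thesis
      proof (cases t)
        case 0
        have "w \<in> descendants w"
          unfolding descendants_def using wV by (auto intro: exI[of _ 0])
        then have "card (descendants w) > 0" using finite_descendants card_gt_0_iff by blast
        then show ?thesis using True 0 by (simp add: level_msg_def)
      next
        case (Suc t')
        have "2 ^ t \<le> card (descendants w)" if "count_level (ms w) t' \<ge> 2"
        proof -
          have "2 ^ t' * 2 \<le> 2 ^ t' * count_level (ms w) t'" using that by (rule mult_le_mono2)
          also have "\<dots> \<le> card (descendants w)" by (rule IH)
          finally show ?thesis using Suc by (simp add: mult.commute)
        qed
        then show ?thesis using True Suc by (simp add: level_msg_def)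
      qed
    next
      case False
      then show ?thesis using IH[of t] by (auto simp: level_msg_def)
    qed
  qed
  have "2 ^ t * count_level (ms v) t \<le> 2 ^ t * (\<Sum>w\<in>children N v. levels w t)"
    unfolding count_level_eq[OF less.prems] by (rule mult_le_mono2) simp
  also have "\<dots> \<le> (\<Sum>w\<in>children N v. card (descendants w))"
    unfolding sum_distrib_left by (rule sum_mono) (rule child)
  also have "\<dots> \<le> card (descendants v)" by (rule sum_card_descendants[OF less.prems])
  finally show ?case .
qed

text \<open>Level \<open>L\<close> would require \<open>2 ^ L > n\<close> descendants, so truncating
  the messages at \<open>L\<close> loses no level.\<close>

lemma count_level_top:
  assumes "v \<in> verts N" shows "count_level (ms v) L = 0"
proof (rule ccontr)
  assume "count_level (ms v) L \<noteq> 0"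
  then have "2 ^ L * 1 \<le> 2 ^ L * count_level (ms v) L" by (intro mult_le_mono2) simp
  also have "\<dots> \<le> card (descendants v)" by (rule count_level_descendants[OF assms])
  also have "\<dots> \<le> card (verts N)"
    by (rule card_mono[OF tree(1)]) (auto simp: descendants_def)
  also have "\<dots> < 2 ^ L" by (rule less_two_power_floorlog)
  finally show False by simp
qed

lemma levels_Suc_L: "levels w (Suc L) = 0"
  by (simp add: level_msg_bounds)

lemma level_of_levels_le: "level_of (levels w) \<le> Suc L"
  unfolding level_of_def by (rule Least_le) (rule levels_Suc_L)

lemma levels_level_of: "levels w (level_of (levels w)) = 0"
  unfolding level_of_def by (rule LeastI[of "\<lambda>t. levels w t = 0"]) (rule levels_Suc_L)

lemma level_of_levels_pos_iff: "level_of (levels w) > 0 \<longleftrightarrow> levels w 0 > 0"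
  by (rule level_of_pos_iff) (rule levels_Suc_L)

text \<open>The level numbered \<open>level_of (levels v) - 1\<close> is reached and the next one is
  not, so fewer than two child clusters are on it. Where \<open>L\<close> cuts off the next level,
  \<open>count_level_top\<close> takes over.\<close>

lemma level_of_cut:
  assumes "v \<in> verts N" "is_cut v"
  shows "level_of (levels v) > 0" "count_level (ms v) (level_of (levels v) - 1) < 2"
proof -
  show pos: "level_of (levels v) > 0"
    unfolding level_of_levels_pos_iff using assms by (simp add: level_msg_def)
  then obtain t where t: "level_of (levels v) = Suc t" using gr0_implies_Suc by blast
  show "count_level (ms v) (level_of (levels v) - 1) < 2"
  proof (cases "Suc t \<le> L")
    case True
    then show ?thesis using levels_level_of[of v] assms(2) unfolding t
      by (simp add: level_msg_def split: if_splits)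
  next
    case False
    then have "t = L" using level_of_levels_le[of v] t by simp
    then show ?thesis using count_level_top[OF assms(1)] t by simp
  qed
qed

lemma level_of_not_cut:
  assumes "v \<in> verts N" "\<not> is_cut v" "t < level_of (levels v)"
  shows "count_level (ms v) t > 0"
  using less_level_of[OF assms(3)] assms(2) by (simp add: level_msg_def split: if_splits)

lemma set_ms:
  assumes "v \<in> verts N"
  shows "set (ms v) = (\<lambda>w. if w \<in> children N v then levels w else (\<lambda>_. 0)) ` neighbours N v"
  by (subst ms_eq[OF assms]) (simp add: set_ports[OF valid assms])

lemma has_best_iff:
  assumes "v \<in> verts N"
  shows "has_best (ms v) \<longleftrightarrow> (\<exists>w \<in> children N v. level_of (levels w) > 0)"
proof -
  have "children N v \<subseteq> neighbours N v" by (auto simp: neighbours_def)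
  then show ?thesis by (auto simp: has_best_def set_ms[OF assms] split: if_splits)
qed

text \<open>The entry for the parent's port is the zero function, so a port with positive level
  leads to a child.\<close>

lemma best_child:
  assumes "v \<in> verts N" "has_best (ms v)"
  shows "best_port (ms v) < deg N v" "best v \<in> children N v" "level_of (levels (best v)) > 0"
    "\<And>w. w \<in> children N v \<Longrightarrow> level_of (levels w) \<le> level_of (levels (best v))"
proof -
  have len: "length (ms v) = deg N v"
    by (subst ms_eq[OF assms(1)]) (simp add: length_ports[OF valid assms(1)])
  show lt: "best_port (ms v) < deg N v" using best_port(1)[OF assms(2)] len by simp
  have nth: "ms v ! best_port (ms v) =
      (if best v \<in> children N v then levels (best v) else (\<lambda>_. 0))"
    using lt length_ports[OF valid assms(1)] by (subst ms_eq[OF assms(1)]) simp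
  show ch: "best v \<in> children N v"
    using best_port(2)[OF assms(2)] unfolding nth by (auto split: if_splits)
  show "level_of (levels (best v)) > 0"
    using best_port(2)[OF assms(2)] ch unfolding nth by simp
  show "level_of (levels w) \<le> level_of (levels (best v))" if "w \<in> children N v" for w
  proof -
    have "levels w \<in> set (ms v)" using that by (auto simp: set_ms[OF assms(1)] neighbours_def)
    then show ?thesis using best_port(3)[OF assms(2)] ch unfolding nth by simp
  qed
qed

end

section \<open>Paths of best children between cut nodes\<close>

section \<open>Selected paths\<close>

corollary level_network_computable:
  assumes "m \<ge> 1"
  shows "\<exists>ms. congest_computable d c (\<lambda>N v. (cut_node m c N v, ms N v)) \<and>
    (\<forall>N. valid_network d c N \<longrightarrow> level_network d c N m (ms N))"
proof -
  obtain ms where "congest_computable d c (\<lambda>N v. (cut_node m c N v, ms N v))"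
    "\<And>N v. valid_network d c N \<Longrightarrow> v \<in> verts N \<Longrightarrow> ms N v = map (\<lambda>w. if w \<in> children N v
      then level_msg (floorlog 2 (card (verts N))) (cut_node m c N w) (ms N w) else (\<lambda>_. 0))
      (ports N v)"
    using levels_computable[OF assms, of d c] by blast
  then show ?thesis using assms
    by (intro exI[of _ ms]) (auto intro!: level_network.intro cut_network.intro tree_network.intro
        cut_network_axioms.intro level_network_axioms.intro)
qed

text \<open>\<open>J v\<close> is the distance from \<open>v\<close> to the next cut node along best children.  Truncation at
  \<open>cut_gap m\<close> only keeps the messages bounded during the computation.\<close>

locale distance_network = level_network +
  fixes J :: "nat \<Rightarrow> nat"
  assumes J_eq: "\<And>v. v \<in> verts N \<Longrightarrow> J v = (if has_best (ms v)
    then Suc (if is_cut (best v) then 0 else min (cut_gap m) (J (best v))) else 0)"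
begin

text \<open>Each step to a best child that is not a cut node increases \<open>cut_dist\<close>,
  which is at most \<open>cut_gap m\<close>. \<open>J_step\<close> draws from this that the
  truncated recursion agrees with the exact one.\<close>

lemma J_le: "v \<in> verts N \<Longrightarrow> J v \<le> Suc (cut_gap m - dist_cut v)"
proof (induction "cut_gap m - dist_cut v" arbitrary: v rule: less_induct)
  case less
  show ?case
  proof (cases "has_best (ms v) \<and> \<not> is_cut (best v)")
    case True
    have w: "best v \<in> verts N" "up N (best v) = v"
      using best_child(2)[OF less.prems] True by (auto simp: children_iff)
    have d: "dist_cut (best v) = Suc (dist_cut v)" using cut_dist_up[OF w(1)] True w(2) by simp
    moreover have le: "dist_cut (best v) \<le> cut_gap m" by (rule cut_dist_le[OF w(1)])
    ultimately have "J (best v) \<le> Suc (cut_gap m - dist_cut (best v))"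
      by (intro less.hyps w) simp
    then have "J (best v) \<le> cut_gap m - dist_cut v" using d le by simp
    then show ?thesis using J_eq[OF less.prems] True by simp
  qed (use J_eq[OF less.prems] in auto)
qed

lemma J_step:
  assumes "v \<in> verts N" "has_best (ms v)"
  shows "J v = Suc (if is_cut (best v) then 0 else J (best v))"
proof -
  have w: "best v \<in> verts N" using best_child(2)[OF assms] by (simp add: children_iff)
  have "J (best v) \<le> cut_gap m" if "\<not> is_cut (best v)"
    using J_le[OF w] cut_dist_up[OF w that] cut_dist_le[OF w] by simp
  then show ?thesis using J_eq[OF assms(1)] assms(2) by simp
qed

text \<open>A best child that is not a cut node reports a positive count at level 0, to which one of
  its own children must contribute. So a path of best children cannot stop before a cut
  node.\<close>

lemma has_best_best:
  assumes "v \<in> verts N" "has_best (ms v)" "\<not> is_cut (best v)"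
  shows "has_best (ms (best v))"
proof -
  have w: "best v \<in> verts N" using best_child(2)[OF assms(1,2)] by (simp add: children_iff)
  have "count_level (ms (best v)) 0 > 0"
    by (rule level_of_not_cut[OF w assms(3) best_child(3)[OF assms(1,2)]])
  then have "(\<Sum>x\<in>children N (best v). levels x 0) \<noteq> 0" unfolding count_level_eq[OF w] by simp
  then obtain x where "x \<in> children N (best v)" "levels x 0 \<noteq> 0" by (meson sum.neutral)
  then show ?thesis using has_best_iff[OF w] level_of_levels_pos_iff by blast
qed

lemma J_reaches_cut:
  "v \<in> verts N \<Longrightarrow> has_best (ms v) \<Longrightarrow>
    \<exists>x\<in>verts N. x \<noteq> root N \<and> is_cut x \<and> (up N ^^ J v) x = v"
proof (induction "J v" arbitrary: v rule: less_induct)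
  case less
  have w: "best v \<in> verts N" "best v \<noteq> root N" "up N (best v) = v"
    using best_child(2)[OF less.prems] by (auto simp: children_iff)
  show ?case
  proof (cases "is_cut (best v)")
    case True
    then show ?thesis using J_step[OF less.prems] w by (intro bexI[of _ "best v"]) auto
  next
    case False
    then have Jv: "J v = Suc (J (best v))" using J_step[OF less.prems] by simp
    then obtain x where "x \<in> verts N" "x \<noteq> root N" "is_cut x" "(up N ^^ J (best v)) x = best v"
      using less.hyps[OF _ w(1) has_best_best[OF less.prems False]] by auto
    then show ?thesis using w(3) Jv by (intro bexI[of _ x]) auto
  qed
qed

text \<open>The path runs between two cut nodes, so \<open>cut_spaced\<close> applies. For
  \<open>m \<ge> K\<close> it is then long enough to steer any label of \<open>S\<close> into
  \<open>a0\<close>.\<close>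

lemma J_cut_ge:
  assumes "v \<in> verts N" "has_best (ms v)" "is_cut v" shows "m \<le> J v"
proof -
  obtain x where "x \<in> verts N" "x \<noteq> root N" "is_cut x" "(up N ^^ J v) x = v"
    using J_reaches_cut[OF assms(1,2)] by blast
  then show ?thesis using cut_spaced[of x "J v"] assms J_step[OF assms(1,2)] by simp
qed

end

text \<open>Truncated distances form a fixed finite set of messages, and dependencies stay within
  one cluster, so constantly many rounds suffice.\<close>

theorem distance_network_computable:
  assumes "m \<ge> 1"
  shows "\<exists>ms J. congest_computable d c (\<lambda>N v. ((cut_node m c N v, ms N v), J N v)) \<and>
    (\<forall>N. valid_network d c N \<longrightarrow> distance_network d c N m (ms N) (J N))"
proof -
  obtain ms where comp: "congest_computable d c (\<lambda>N v. (cut_node m c N v, ms N v))"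
    and ms: "\<And>N. valid_network d c N \<Longrightarrow> level_network d c N m (ms N)"
    using level_network_computable[OF assms, of d c] by blast
  let ?D = "cut_gap m"
  define f where "f = (\<lambda>N v. (cut_node m c N v, ms N v))"
  define F0 where "F0 = (\<lambda>(k::knowledge) (y :: bool \<times> (nat \<Rightarrow> nat) list). 0 :: nat)"
  define F where "F = (\<lambda>(k::knowledge) (y :: bool \<times> (nat \<Rightarrow> nat) list) (s::nat) js.
    if has_best (snd y) then Suc (js ! best_port (snd y)) else 0)"
  define msg where "msg = (\<lambda>(k::knowledge) (y :: bool \<times> (nat \<Rightarrow> nat) list) (s::nat) (p::nat).
    if fst y then 0 else min ?D s)"
  have F: "F k y s js = (if has_best (snd y) then Suc (js ! best_port (snd y)) else 0)"
    and msg: "msg k y s p = (if fst y then 0 else min ?D s)" for k y s js p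
    by (simp_all add: F_def msg_def)
  define st where "st = local_iter F0 F msg f"
  have comp_J: "congest_computable d c (\<lambda>N v. (f N v, local_iter F0 F msg f N (Suc ?D) v))"
  proof (rule congest_computable_iter)
    show "congest_computable d c f" using comp by (simp only: f_def)
    show "finite {..?D}" by simp
    show "card {..?D} \<le> 2 ^ Suc ?D" using less_exp[of "Suc ?D"] by simp
    show "(\<lambda>n. real (Suc ?D)) \<in> O(\<lambda>n. ln (real n))"
      "(\<lambda>n. real (Suc ?D)) \<in> O(\<lambda>n. ln (real n))"
      using log_bits_bigo[of 0 "Suc ?D"] by simp_all
  qed (auto simp: msg)
  have "distance_network d c N m (ms N) (st N (Suc ?D))" if N: "valid_network d c N" for N
  proof -
    interpret level_network d c N m "ms N" by (rule ms[OF N])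
    have step: "st N (Suc r) v = (if has_best (ms N v)
        then Suc (if is_cut (best v) then 0 else min ?D (st N r (best v))) else 0)"
      if v: "v \<in> verts N" for r v
    proof (cases "has_best (ms N v)")
      case True
      have "best_port (ms N v) < length (ports N v)"
        using best_child(1)[OF v True] length_ports[OF valid v] by simp
      then show ?thesis using True unfolding st_def local_iter.simps by (simp add: F msg f_def)
    next
      case False
      then show ?thesis unfolding st_def local_iter.simps by (simp add: F f_def)
    qed
    define rank where "rank = (\<lambda>v. ?D - dist_cut v)"
    have stable: "st N (Suc (Suc ?D)) v = st N (Suc ?D) v" if "v \<in> verts N" for v
    proof (rule ranked_iteration_stable[where X = "verts N" and rank = rank and g = "st N"])
      fix r r' v
      assume v: "v \<in> verts N"
        and IH: "\<And>w. w \<in> verts N \<Longrightarrow> rank w < rank v \<Longrightarrow> st N r w = st N r' w"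
      show "st N (Suc r) v = st N (Suc r') v"
      proof (cases "has_best (ms N v) \<and> \<not> is_cut (best v)")
        case True
        have w: "best v \<in> verts N" "up N (best v) = v"
          using best_child(2)[OF v] True by (auto simp: children_iff)
        have "rank (best v) < rank v"
          using cut_dist_up[OF w(1)] True w(2) cut_dist_le[OF w(1)] by (simp add: rank_def)
        from IH[OF w(1) this] show ?thesis unfolding step[OF v] by simp
      qed (simp add: step[OF v])
    qed (use that in \<open>simp_all add: rank_def\<close>)
    show ?thesis
    proof (unfold_locales)
      fix v assume v: "v \<in> verts N"
      show "st N (Suc ?D) v = (if has_best (ms N v)
          then Suc (if is_cut (best v) then 0 else min ?D (st N (Suc ?D) (best v))) else 0)"
        using stable[OF v] unfolding step[OF v] by simp
    qed
  qed
  then show ?thesis using comp_J unfolding f_def st_def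
    by (intro exI[of _ ms] exI[of _ "\<lambda>N. local_iter F0 F msg
        (\<lambda>N v. (cut_node m c N v, ms N v)) N (Suc ?D)"]) simp
qed

text \<open>The nodes with \<open>sel\<close> form the paths of best children from each cluster root down to and
  including the next cut node.\<close>

locale selection_network = distance_network +
  fixes sel :: "nat \<Rightarrow> bool"
  assumes sel_eq: "\<And>v. v \<in> verts N \<Longrightarrow> sel v \<longleftrightarrow> v \<noteq> root N \<and>
    (is_cut (up N v) \<or> sel (up N v)) \<and> has_best (ms (up N v)) \<and> best (up N v) = v"
begin

text \<open>Two cluster children reaching the level of the cluster root would raise that level.\<close>

lemma selected_if_high:
  assumes "u \<in> verts N" "w \<in> children N u"
    and "level_of (levels (cl u)) \<le> level_of (levels w)"
  shows "count_level (ms u) (level_of (levels (cl u)) - 1) < 2 \<and> sel w"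
  using assms
proof (induction "dist_cut u" arbitrary: u w rule: less_induct)
  case (less u w)
  note u = less.prems(1) and w = less.prems(2)
  \<comment> \<open>The highest level of the cluster that contains \<open>u\<close>.\<close>
  define t0 where "t0 = level_of (levels (cl u)) - 1"
  have pos: "level_of (levels (cl u)) > 0"
    by (rule level_of_cut(1)[OF cluster_in_verts[OF u] cut_cluster[OF u]])
  then have t0: "t0 < level_of (levels w)" using less.prems(3) by (simp add: t0_def)
  have t0L: "t0 \<le> L" using t0 level_of_levels_le[of w] by simp
  have count_ge: "levels x t \<le> count_level (ms v) t" if "v \<in> verts N" "x \<in> children N v" for v x t
  proof -
    have "levels x t \<le> (\<Sum>x\<in>children N v. levels x t)"
      by (rule member_le_sum[OF that(2) _ finite_children]) simp
    then show ?thesis unfolding count_level_eq[OF that(1)] using level_msg_bounds(1) by simp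
  qed
  have tok: "count_level (ms u) t0 < 2 \<and> (is_cut u \<or> sel u)"
  proof (cases "is_cut u")
    case True
    then show ?thesis using level_of_cut(2)[OF u True] cluster_cut[OF True] by (simp add: t0_def)
  next
    case False
    have ur: "u \<noteq> root N" using False by auto
    have pu: "up N u \<in> verts N" "u \<in> children N (up N u)"
      using u ur by (auto simp: up_in_verts children_iff)
    have cl: "cl (up N u) = cl u" by (rule cluster_up[OF u False])
    \<comment> \<open>As \<open>u\<close> is not a cut node, it forwards the positive counts coming
      from \<open>w\<close>. So \<open>u\<close> also reaches the level of the cluster, and the
      induction hypothesis applies to it as a child of its parent.\<close>
    have "levels u t > 0" if "t \<le> t0" for t
    proof -
      have "0 < levels w t" by (rule less_level_of) (use that t0 in simp)
      also have "\<dots> \<le> count_level (ms u) t" by (rule count_ge[OF u w])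
      finally show ?thesis using False that t0L by (simp add: level_msg_def)
    qed
    then have "t0 < level_of (levels u)"
      using levels_level_of[of u] by (metis less_numeral_extra(3) not_less)
    then have "level_of (levels (cl (up N u))) \<le> level_of (levels u)"
      unfolding cl using pos by (simp add: t0_def)
    from less.hyps[OF _ pu this] have IH: "count_level (ms (up N u)) t0 < 2" "sel u"
      unfolding cl t0_def using cut_dist_up[OF u False] by simp_all
    have "count_level (ms u) t0 = levels u t0" using False t0L by (simp add: level_msg_def)
    also have "\<dots> \<le> count_level (ms (up N u)) t0" by (rule count_ge[OF pu])
    finally show ?thesis using IH by simp
  qed
  have hb: "has_best (ms u)" unfolding has_best_iff[OF u] using w t0 by (metis gr_zeroI not_less0)
  \<comment> \<open>Otherwise the best child, having at least the level of \<open>w\<close>, would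
    be a second child counted at \<open>t0\<close>.\<close>
  have "best u = w"
  proof (rule ccontr)
    assume neq: "best u \<noteq> w"
    have "levels (best u) t0 > 0"
      by (rule less_level_of) (use t0 best_child(4)[OF u hb w] in simp)
    moreover have "levels w t0 > 0" by (rule less_level_of[OF t0])
    ultimately have "2 \<le> (\<Sum>x\<in>{best u, w}. levels x t0)" using neq by simp
    also have "\<dots> \<le> (\<Sum>x\<in>children N u. levels x t0)"
      by (rule sum_mono2[OF finite_children]) (use best_child(2)[OF u hb] w in auto)
    finally have "count_level (ms u) t0 \<ge> 2" unfolding count_level_eq[OF u] by simp
    then show False using tok by simp
  qed
  moreover have "w \<in> verts N" "w \<noteq> root N" "up N w = u" using w by (simp_all add: children_iff)
  ultimately show ?case using tok hb sel_eq[of w] by (simp add: t0_def)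
qed

text \<open>Governs when the label of \<open>v\<close> is settled: lexicographic in the level its
  cluster lacks and the distance to the cluster root. It is logarithmic, as there are
  \<open>O(log n)\<close> levels and clusters have constant depth.\<close>

definition label_rank :: "nat \<Rightarrow> nat" where
  "label_rank v = (Suc L - level_of (levels (cl v))) * Suc (cut_gap m) + dist_cut v"

lemma label_rank_le:
  assumes "v \<in> verts N" shows "label_rank v \<le> Suc L * Suc (cut_gap m) + cut_gap m"
  unfolding label_rank_def by (intro add_mono mult_le_mono1 cut_dist_le assms) simp

text \<open>Inside a cluster the distance drops. An unselected cluster root has, by
  \<open>selected_if_high\<close>, a smaller level than the cluster above, which outweighs any
  distance inside that cluster.\<close>

lemma label_rank_up:
  assumes v: "v \<in> verts N" "v \<noteq> root N" and unsel: "\<not> (is_cut v \<and> sel v)"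
  shows "label_rank (up N v) < label_rank v"
proof (cases "is_cut v")
  case False
  then show ?thesis using cluster_up[OF v(1)] cut_dist_up[OF v(1)] by (simp add: label_rank_def)
next
  case True
  let ?a = "level_of (levels (cl (up N v)))" and ?b = "level_of (levels v)"
  have p: "up N v \<in> verts N" "v \<in> children N (up N v)"
    using v by (simp_all add: up_in_verts children_iff)
  have "?b < ?a" using selected_if_high[OF p] unsel True by (metis not_less)
  then have "Suc (Suc L - ?a) \<le> Suc L - ?b" using level_of_levels_le[of "cl (up N v)"] by simp
  then have "Suc (Suc L - ?a) * Suc (cut_gap m) \<le> (Suc L - ?b) * Suc (cut_gap m)"
    by (rule mult_le_mono1)
  moreover have "dist_cut (up N v) \<le> cut_gap m" by (rule cut_dist_le[OF p(1)])
  ultimately show ?thesis unfolding label_rank_def cluster_cut[OF True] by simp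
qed

end

text \<open>A cut or selected node announces the next path node by one bit through its best port.
  The chain of dependencies ends at the cluster root above, so constantly many rounds
  suffice.\<close>

theorem selection_network_computable:
  assumes "m \<ge> 1"
  shows "\<exists>ms J sel.
    congest_computable d c (\<lambda>N v. (((cut_node m c N v, ms N v), J N v), sel N v)) \<and>
    (\<forall>N. valid_network d c N \<longrightarrow> selection_network d c N m (ms N) (J N) (sel N))"
proof -
  obtain ms J where comp: "congest_computable d c (\<lambda>N v. ((cut_node m c N v, ms N v), J N v))"
    and ms: "\<And>N. valid_network d c N \<Longrightarrow> distance_network d c N m (ms N) (J N)"
    using distance_network_computable[OF assms, of d c] by blast
  let ?D = "cut_gap m"
  define f where "f = (\<lambda>N v. ((cut_node m c N v, ms N v), J N v :: nat))"
  define F0 where "F0 = (\<lambda>(k::knowledge) (y :: (bool \<times> (nat \<Rightarrow> nat) list) \<times> nat). False)"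
  define F where "F = (\<lambda>(k::knowledge) (y :: (bool \<times> (nat \<Rightarrow> nat) list) \<times> nat) (s::bool) bs.
    case parent_port k of None \<Rightarrow> False | Some p \<Rightarrow> bs ! p)"
  define msg where "msg = (\<lambda>(k::knowledge) (y :: (bool \<times> (nat \<Rightarrow> nat) list) \<times> nat) (s::bool) p.
    (fst (fst y) \<or> s) \<and> has_best (snd (fst y)) \<and> p = best_port (snd (fst y)))"
  have F: "F k y s bs = (case parent_port k of None \<Rightarrow> False | Some p \<Rightarrow> bs ! p)"
    and msg: "msg k y s p =
      ((fst (fst y) \<or> s) \<and> has_best (snd (fst y)) \<and> p = best_port (snd (fst y)))" for k y s bs p
    by (simp_all add: F_def msg_def)
  define st where "st = local_iter F0 F msg f"
  have comp_sel: "congest_computable d c (\<lambda>N v. (f N v, local_iter F0 F msg f N (?D + 2) v))"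
  proof (rule congest_computable_iter)
    show "congest_computable d c f" using comp by (simp only: f_def)
    show "finite (UNIV :: bool set)" "card (UNIV :: bool set) \<le> 2 ^ 1" by (simp_all add: card_UNIV_bool)
    show "(\<lambda>n. real 1) \<in> O(\<lambda>n. ln (real n))" "(\<lambda>n. real (?D + 2)) \<in> O(\<lambda>n. ln (real n))"
      using log_bits_bigo[of 0 1] log_bits_bigo[of 0 "?D + 2"] by simp_all
  qed simp
  have "selection_network d c N m (ms N) (J N) (st N (?D + 2))" if N: "valid_network d c N" for N
  proof -
    interpret distance_network d c N m "ms N" "J N" by (rule ms[OF N])
    have step: "st N (Suc r) v \<longleftrightarrow> v \<noteq> root N \<and> (is_cut (up N v) \<or> st N r (up N v)) \<and>
        has_best (ms N (up N v)) \<and> best (up N v) = v"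
      if v: "v \<in> verts N" for r v
    proof (cases "v = root N")
      case True
      then show ?thesis unfolding st_def local_iter.simps by (simp add: F parent_port_initial)
    next
      case False
      let ?p = "up N v"
      have p: "?p \<in> verts N" "v \<in> neighbours N ?p"
        using v False by (auto simp: up_in_verts neighbours_def children_iff)
      have "port_to N ?p v = best_port (ms N ?p) \<longleftrightarrow> best ?p = v" if "has_best (ms N ?p)"
        using port_to(2)[OF valid p] port_to_nth[OF valid p(1) best_child(1)[OF p(1) that]] by auto
      moreover have "st N (Suc r) v = msg (initial_knowledge N ?p) (f N ?p) (st N r ?p) (port_to N ?p v)"
        unfolding st_def local_iter.simps F[of "initial_knowledge N v"] parent_port_initial
        by (simp only: False if_False option.case parent_message[OF v False])
      ultimately show ?thesis using False by (auto simp: msg f_def)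
    qed
    \<comment> \<open>Measured from the parent, because \<open>v\<close> may itself be the cut node
      that ends a path.\<close>
    define rank where "rank = (\<lambda>v. if v = root N then 0 else Suc (dist_cut (up N v)))"
    have stable: "st N (Suc (?D + 2)) v = st N (?D + 2) v" if "v \<in> verts N" for v
    proof (rule ranked_iteration_stable[where X = "verts N" and rank = rank and g = "st N"])
      fix r r' v
      assume v: "v \<in> verts N"
        and IH: "\<And>w. w \<in> verts N \<Longrightarrow> rank w < rank v \<Longrightarrow> st N r w = st N r' w"
      show "st N (Suc r) v = st N (Suc r') v"
      proof (cases "v \<noteq> root N \<and> \<not> is_cut (up N v)")
        case True
        have p: "up N v \<in> verts N" "up N v \<noteq> root N" using True up_in_verts[OF v] by auto
        have "rank (up N v) < rank v"
          using True p cut_dist_up[OF p(1)] by (simp add: rank_def)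
        from IH[OF p(1) this] show ?thesis unfolding step[OF v] by simp
      qed (auto simp: step[OF v])
    next
      show "rank v < ?D + 2" using cut_dist_le[OF up_in_verts[OF that]] by (simp add: rank_def)
    qed (rule that)
    show ?thesis
    proof (unfold_locales)
      fix v assume v: "v \<in> verts N"
      show "st N (?D + 2) v \<longleftrightarrow> v \<noteq> root N \<and> (is_cut (up N v) \<or> st N (?D + 2) (up N v)) \<and>
          has_best (ms N (up N v)) \<and> best (up N v) = v"
        using stable[OF v] unfolding step[OF v] by simp
    qed
  qed
  then show ?thesis using comp_sel unfolding f_def st_def
    by (intro exI[of _ ms] exI[of _ J] exI[of _ "\<lambda>N. local_iter F0 F msg
        (\<lambda>N v. ((cut_node m c N v, ms N v), J N v)) N (?D + 2)"]) simp
qed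

section \<open>Steering labels along selected paths\<close>

section \<open>Labelling from the cut nodes downwards\<close>

text \<open>Used to put a prescribed port at the position where a configuration has the desired
  label.\<close>

lemma list_with_nth:
  assumes "finite P" "p \<in> P" "i < card P"
  obtains ps where "distinct ps" "set ps = P" "ps ! i = p"
proof -
  obtain rs where rs: "distinct rs" "set rs = P - {p}"
    using finite_distinct_list[of "P - {p}"] assms(1) by blast
  have len: "length rs = card P - 1"
    using distinct_card[OF rs(1)] rs(2) assms(1,2) by simp
  have "set (take i rs) \<union> set (drop i rs) = P - {p}"
    using rs(2) by (metis append_take_drop_id set_append)
  moreover have "set (take i rs) \<inter> set (drop i rs) = {}"
    by (rule set_take_disj_set_drop_if_distinct[OF rs(1)]) simp
  ultimately show ?thesis using rs(1) len assms(2,3)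
    by (intro that[of "take i rs @ p # drop i rs"]) (auto simp: nth_append)
qed

locale flexible_labels =
  fixes \<Pi> :: "'a lcl" and S :: "'a set" and a0 :: 'a and K :: nat and W :: "nat \<Rightarrow> 'a \<Rightarrow> bool"
  assumes lcl: "lcl_problem \<Pi>"
    and finite_S: "finite S" and S_labels: "S \<subseteq> labels \<Pi>" and a0: "a0 \<in> S"
    and W_flexible: "\<And>a j. a \<in> S \<Longrightarrow> j \<ge> K \<Longrightarrow> W j a"
    and W_0: "\<And>a. W 0 a \<Longrightarrow> a = a0"
    and W_Suc: "\<And>a j. a \<in> S \<Longrightarrow> W (Suc j) a \<Longrightarrow>
      \<exists>bs. (a, bs) \<in> configs \<Pi> \<and> set bs \<subseteq> S \<and> (\<exists>b \<in> set bs. W j b)"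
begin

text \<open>\<open>con = Some (p, j)\<close> asks the label at port \<open>p\<close> to start a walk of length \<open>j\<close> to \<open>a0\<close>.\<close>

definition good_assignment ::
  "nat set \<Rightarrow> 'a \<Rightarrow> (nat \<times> nat) option \<Rightarrow> (nat \<Rightarrow> 'a) \<Rightarrow> bool" where
  "good_assignment P a con \<alpha> \<longleftrightarrow>
     (\<exists>ps. distinct ps \<and> set ps = P \<and> (a, map \<alpha> ps) \<in> configs \<Pi>) \<and> \<alpha> ` P \<subseteq> S \<and>
     (\<forall>p j. con = Some (p, j) \<longrightarrow> W j (\<alpha> p))"

definition assignment :: "nat set \<Rightarrow> 'a \<Rightarrow> (nat \<times> nat) option \<Rightarrow> nat \<Rightarrow> 'a" where
  "assignment P a con = (SOME \<alpha>. good_assignment P a con \<alpha>)"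

text \<open>The configuration from \<open>W_Suc\<close> is laid out so that the label continuing the
  walk lands on the requested port.\<close>

lemma good_assignment:
  assumes P: "finite P" "card P = arity \<Pi>" and a: "a \<in> S"
    and con: "\<And>p j. con = Some (p, j) \<Longrightarrow> p \<in> P \<and> W (Suc j) a"
  shows "good_assignment P a con (assignment P a con)"
proof -
  have "P \<noteq> {}" using P lcl by (auto simp: lcl_problem_def)
  \<comment> \<open>Without a request, any port and the length \<open>K\<close> serve: flexibility
    gives a walk of length \<open>Suc K\<close>, hence a configuration inside
    \<open>S\<close>.\<close>
  define q where "q = (case con of None \<Rightarrow> SOME p. p \<in> P | Some (p, j) \<Rightarrow> p)"
  define j where "j = (case con of None \<Rightarrow> K | Some (p, j) \<Rightarrow> j)"
  have q: "q \<in> P" and W: "W (Suc j) a"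
    using con W_flexible[OF a, of "Suc K"] \<open>P \<noteq> {}\<close>
    by (auto simp: q_def j_def some_in_eq split: option.splits)
  obtain bs b where bs: "(a, bs) \<in> configs \<Pi>" "set bs \<subseteq> S" "b \<in> set bs" "W j b"
    using W_Suc[OF a W] by blast
  have len: "length bs = card P" using lcl bs(1) P(2) by (auto simp: lcl_problem_def)
  obtain i where i: "i < length bs" "bs ! i = b" using bs(3) by (auto simp: in_set_conv_nth)
  obtain ps where ps: "distinct ps" "set ps = P" "ps ! i = q"
    using list_with_nth[OF P(1) q] i(1) len by metis
  have lps: "length ps = length bs" using distinct_card[OF ps(1)] ps(2) len by simp
  define \<alpha> where "\<alpha> = (\<lambda>p. the (map_of (zip ps bs) p))"
  have nth: "\<alpha> (ps ! k) = bs ! k" if "k < length bs" for k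
    unfolding \<alpha>_def using map_of_zip_nth[OF lps ps(1) that] by simp
  have map: "map \<alpha> ps = bs" by (rule nth_equalityI) (simp_all add: lps nth)
  have "good_assignment P a con \<alpha>"
    unfolding good_assignment_def
  proof (intro conjI allI impI)
    show "\<exists>ps. distinct ps \<and> set ps = P \<and> (a, map \<alpha> ps) \<in> configs \<Pi>"
      using ps map bs(1) by blast
    show "\<alpha> ` P \<subseteq> S" using bs(2) map ps(2) by (metis set_map)
    show "W j' (\<alpha> p)" if "con = Some (p, j')" for p j'
    proof -
      have "q = p" "j = j'" using that by (simp_all add: q_def j_def)
      then show ?thesis using nth[OF i(1)] i(2) ps(3) bs(4) by simp
    qed
  qed
  then show ?thesis unfolding assignment_def by (rule someI[where P = "good_assignment P a con"])
qed

text \<open>Before labels have settled, a request may be unsatisfiable and \<open>assignment\<close>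
  unspecified; capping keeps every message in \<open>S\<close>. The values of a good assignment at
  its ports already lie there.\<close>

definition cap :: "'a \<Rightarrow> 'a" where
  "cap x = (if x \<in> S then x else a0)"

lemma cap_in_S: "cap x \<in> S" using a0 by (simp add: cap_def)

definition child_ports :: "knowledge \<Rightarrow> nat set" where
  "child_ports k = {p. p < own_degree k \<and> parent_port k \<noteq> Some p}"

text \<open>Requests are made on selected paths, including their starting cut nodes. The child at
  the best port is one step nearer to the end, hence \<open>j - 1\<close>.\<close>

definition constraint :: "(((bool \<times> (nat \<Rightarrow> nat) list) \<times> nat) \<times> bool) \<Rightarrow> (nat \<times> nat) option" where
  "constraint y = (case y of (((b, ms), j), s) \<Rightarrow>
     if (b \<or> s) \<and> has_best ms then Some (best_port ms, j - 1) else None)"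

definition child_label ::
  "knowledge \<Rightarrow> (((bool \<times> (nat \<Rightarrow> nat) list) \<times> nat) \<times> bool) \<Rightarrow> 'a \<Rightarrow> nat \<Rightarrow> 'a" where
  "child_label k y l p = cap (assignment (child_ports k) l (constraint y) p)"

end

locale label_network = selection_network + flexible_labels \<Pi> S a0 K W
  for \<Pi> :: "'a lcl" and S a0 K W +
  fixes lab :: "nat \<Rightarrow> 'a"
  assumes arity: "d = arity \<Pi>" and K_le: "K \<le> m"
    and lab_eq: "\<And>v. v \<in> verts N \<Longrightarrow> lab v = (if v = root N \<or> is_cut v \<and> sel v then a0
      else child_label (initial_knowledge N (up N v))
        (((is_cut (up N v), ms (up N v)), J (up N v)), sel (up N v))
        (lab (up N v)) (port_to N (up N v) v))"
begin

abbreviation "con v \<equiv> constraint (((is_cut v, ms v), J v), sel v)"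
abbreviation "cports v \<equiv> child_ports (initial_knowledge N v)"
abbreviation "\<alpha> v \<equiv> assignment (cports v) (lab v) (con v)"

lemma con_eq_Some_iff: "con v = Some (p, j) \<longleftrightarrow>
    (is_cut v \<or> sel v) \<and> has_best (ms v) \<and> p = best_port (ms v) \<and> j = J v - 1"
  by (auto simp: constraint_def)

lemma lab_in_S: "v \<in> verts N \<Longrightarrow> lab v \<in> S"
  using a0 by (simp add: lab_eq child_label_def cap_in_S)

lemma cports_iff:
  assumes "v \<in> verts N"
  shows "p \<in> cports v \<longleftrightarrow> p < deg N v \<and> ports N v ! p \<in> children N v"
proof -
  have "parent_port (initial_knowledge N v) \<noteq> Some p \<longleftrightarrow> ports N v ! p \<in> children N v"
    if p: "p < deg N v"
  proof -
    let ?w = "ports N v ! p"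
    have w: "?w \<in> neighbours N v"
      using p length_ports[OF valid assms] set_ports[OF valid assms] nth_mem by metis
    have pt: "port_to N v ?w = p" by (rule port_to_nth[OF valid assms p])
    show ?thesis
    proof
      assume *: "parent_port (initial_knowledge N v) \<noteq> Some p"
      show "?w \<in> children N v"
      proof (rule ccontr)
        assume "?w \<notin> children N v"
        then have "v \<noteq> root N" "?w = parent N v"
          using w by (auto simp: neighbours_def split: if_splits)
        then show False using * pt by (simp add: parent_port_initial)
      qed
    next
      assume ch: "?w \<in> children N v"
      show "parent_port (initial_knowledge N v) \<noteq> Some p"
      proof
        assume "parent_port (initial_knowledge N v) = Some p"
        then have r: "v \<noteq> root N" and q: "port_to N v (parent N v) = p"
          by (auto simp: parent_port_initial split: if_splits)
        then have "parent N v = ?w"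
          using port_to(2)[OF valid assms, of "parent N v"] by (simp add: neighbours_def)
        then have "up N v = ?w" using r by (simp add: up_nonroot)
        \<comment> \<open>By depth, no neighbour is both the parent and a child of
          \<open>v\<close>.\<close>
        then have "depth N v = Suc (depth N ?w)" using depth_up[OF assms r] by simp
        then show False using depth_child[OF ch] by simp
      qed
    qed
  qed
  then show ?thesis by (auto simp: child_ports_def initial_knowledge_def)
qed

lemma bij_betw_cports:
  assumes "v \<in> verts N" shows "bij_betw (\<lambda>p. ports N v ! p) (cports v) (children N v)"
proof (rule bij_betw_byWitness[where f' = "port_to N v"])
  have ch: "w \<in> neighbours N v" if "w \<in> children N v" for w
    using that by (simp add: neighbours_def)
  show "\<forall>p\<in>cports v. port_to N v (ports N v ! p) = p"
    using port_to_nth[OF valid assms] by (simp add: cports_iff[OF assms])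
  show "\<forall>w\<in>children N v. ports N v ! port_to N v w = w"
    using port_to(2)[OF valid assms ch] by blast
  show "(\<lambda>p. ports N v ! p) ` cports v \<subseteq> children N v"
    by (auto simp: cports_iff[OF assms])
  show "port_to N v ` children N v \<subseteq> cports v"
    using port_to[OF valid assms ch] by (auto simp: cports_iff[OF assms])
qed

lemma best_port_in_cports:
  assumes "v \<in> verts N" "has_best (ms v)" shows "best_port (ms v) \<in> cports v"
  using best_child(1,2)[OF assms] by (simp add: cports_iff[OF assms(1)])

lemma good_if_walk:
  assumes v: "v \<in> verts N" "children N v \<noteq> {}"
    and walk: "is_cut v \<or> sel v \<Longrightarrow> has_best (ms v) \<Longrightarrow> W (J v) (lab v)"
  shows "good_assignment (cports v) (lab v) (con v) (\<alpha> v)"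
proof (rule good_assignment)
  show "finite (cports v)" by (auto simp: child_ports_def)
  have "card (children N v) = d"
    using valid v by (auto simp: valid_network_def full_tree_def)
  then show "card (cports v) = arity \<Pi>"
    using bij_betw_same_card[OF bij_betw_cports[OF v(1)]] arity by simp
  show "lab v \<in> S" by (rule lab_in_S[OF v(1)])
  fix p j assume "con v = Some (p, j)"
  then have c: "is_cut v \<or> sel v" "has_best (ms v)" "p = best_port (ms v)" "j = J v - 1"
    by (simp_all add: con_eq_Some_iff)
  then show "p \<in> cports v \<and> W (Suc j) (lab v)"
    using walk best_port_in_cports[OF v(1)] J_step[OF v(1)] by simp
qed

lemma lab_child:
  assumes v: "v \<in> verts N" and w: "w \<in> children N v" "\<not> (is_cut w \<and> sel w)"
    and good: "good_assignment (cports v) (lab v) (con v) (\<alpha> v)"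
  shows "lab w = \<alpha> v (port_to N v w)"
proof -
  have wV: "w \<in> verts N" "w \<noteq> root N" "up N w = v" using w(1) by (simp_all add: children_iff)
  have "w \<in> neighbours N v" using w(1) by (simp add: neighbours_def)
  then have "port_to N v w \<in> cports v"
    using port_to[OF valid v] w(1) by (simp add: cports_iff[OF v])
  then have "\<alpha> v (port_to N v w) \<in> S" using good by (auto simp: good_assignment_def)
  then show ?thesis using lab_eq[OF wV(1)] wV w(2) by (simp add: child_label_def cap_def)
qed

lemma port_to_best:
  assumes "v \<in> verts N" "has_best (ms v)" shows "port_to N v (best v) = best_port (ms v)"
  by (rule port_to_nth[OF valid assms(1) best_child(1)[OF assms]])

text \<open>At a cut node \<open>J v \<ge> m \<ge> K\<close>, so every label of \<open>S\<close> has
  the required walk. Farther down the path, the parent's assignment was asked to provide it.\<close>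

lemma walk:
  "v \<in> verts N \<Longrightarrow> is_cut v \<or> sel v \<Longrightarrow> has_best (ms v) \<Longrightarrow> W (J v) (lab v)"
proof (induction "dist_cut v" arbitrary: v rule: less_induct)
  case less
  show ?case
  proof (cases "is_cut v")
    case True
    then show ?thesis
      using W_flexible[OF lab_in_S] J_cut_ge less.prems K_le by (meson le_trans)
  next
    case False
    then have s: "sel v" using less.prems by simp
    let ?p = "up N v"
    have p: "?p \<in> verts N" "is_cut ?p \<or> sel ?p" "has_best (ms ?p)" "best ?p = v"
      and r: "v \<noteq> root N"
      using sel_eq[OF less.prems(1)] s up_in_verts[OF less.prems(1)] by auto
    have ch: "v \<in> children N ?p" using less.prems(1) r by (simp add: children_iff)
    have "W (J ?p) (lab ?p)"
      by (rule less.hyps) (use p cut_dist_up[OF less.prems(1) False] in simp_all)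
    then have good: "good_assignment (cports ?p) (lab ?p) (con ?p) (\<alpha> ?p)"
      using good_if_walk[OF p(1)] ch by blast
    have "con ?p = Some (best_port (ms ?p), J v)"
      unfolding con_eq_Some_iff using p J_step[OF p(1,3)] False by simp
    then have "W (J v) (\<alpha> ?p (best_port (ms ?p)))" using good by (simp add: good_assignment_def)
    moreover have "lab v = \<alpha> ?p (port_to N ?p v)"
      by (rule lab_child[OF p(1) ch _ good]) (use False in simp)
    moreover have "port_to N ?p v = best_port (ms ?p)" using port_to_best[OF p(1,3)] p(4) by simp
    ultimately show ?thesis by simp
  qed
qed

lemma solution_lab: "solution \<Pi> N lab"
  unfolding solution_def
proof (intro conjI ballI impI)
  fix v assume v: "v \<in> verts N"
  show "lab v \<in> labels \<Pi>" using lab_in_S[OF v] S_labels by blast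
  assume "children N v \<noteq> {}"
  then have good: "good_assignment (cports v) (lab v) (con v) (\<alpha> v)"
    using good_if_walk[OF v] walk[OF v] by blast
  then obtain ps where ps: "distinct ps" "set ps = cports v" "(lab v, map (\<alpha> v) ps) \<in> configs \<Pi>"
    by (auto simp: good_assignment_def)
  define vs where "vs = map (\<lambda>p. ports N v ! p) ps"
  have "distinct vs" "set vs = children N v"
    using ps(1,2) bij_betw_cports[OF v] by (auto simp: vs_def bij_betw_def distinct_map)
  moreover have "lab (ports N v ! p) = \<alpha> v p" if "p \<in> cports v" for p
  proof -
    let ?w = "ports N v ! p"
    have p: "p < deg N v" and ch: "?w \<in> children N v" using that by (simp_all add: cports_iff[OF v])
    have pt: "port_to N v ?w = p" by (rule port_to_nth[OF valid v p])
    show ?thesis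
    proof (cases "is_cut ?w \<and> sel ?w")
      case True
      have w: "?w \<in> verts N" "up N ?w = v" using ch by (simp_all add: children_iff)
      have c: "is_cut v \<or> sel v" "has_best (ms v)" "best v = ?w"
        using sel_eq[OF w(1)] True w(2) by simp_all
      have "p = best_port (ms v)" using port_to_best[OF v c(2)] c(3) pt by simp
      moreover have "J v = 1" using J_step[OF v c(2)] c(3) True by simp
      \<comment> \<open>A walk of length 0 forces the assigned label to be \<open>a0\<close>, to
        which this child was fixed in advance; so the configuration at \<open>v\<close> is
        respected.\<close>
      ultimately have "con v = Some (p, 0)" unfolding con_eq_Some_iff using c by simp
      then have "\<alpha> v p = a0" using good W_0 by (auto simp: good_assignment_def)
      then show ?thesis using lab_eq[OF w(1)] True by simp
    next
      case False
      then show ?thesis using lab_child[OF v ch _ good] pt by simp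
    qed
  qed
  then have "map lab vs = map (\<alpha> v) ps" using ps(2) by (simp add: vs_def)
  ultimately show "\<exists>vs. distinct vs \<and> set vs = children N v \<and> (lab v, map lab vs) \<in> configs \<Pi>"
    using ps(3) by metis
qed

end

section \<open>The labelling as a computation with logarithmically many rounds\<close>

context flexible_labels begin

text \<open>Labels travel downwards, restarting at the root and at selected cut nodes, and
  \<open>label_rank\<close> bounds the waiting time. Messages are labels of \<open>S\<close>, hence
  of constant size.\<close>

lemma labelling_computable:
  "\<exists>lab. congest_computable (arity \<Pi>) c lab \<and>
    (\<forall>N. valid_network (arity \<Pi>) c N \<longrightarrow> solution \<Pi> N (lab N))"
proof -
  let ?d = "arity \<Pi>"
  define m where "m = max 1 K"
  have m: "m \<ge> 1" "K \<le> m" by (simp_all add: m_def)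
  obtain ms J sel where
    comp: "congest_computable ?d c (\<lambda>N v. (((cut_node m c N v, ms N v), J N v), sel N v))"
    and ms: "\<And>N. valid_network ?d c N \<Longrightarrow> selection_network ?d c N m (ms N) (J N) (sel N)"
    using selection_network_computable[OF m(1), of ?d c] by blast
  let ?D = "cut_gap m"
  define f where "f = (\<lambda>N v. (((cut_node m c N v, ms N v), J N v :: nat), sel N v))"
  define F0 where "F0 = (\<lambda>(k::knowledge) (y :: ((bool \<times> (nat \<Rightarrow> nat) list) \<times> nat) \<times> bool). a0)"
  define F where "F = (\<lambda>(k::knowledge) (y :: ((bool \<times> (nat \<Rightarrow> nat) list) \<times> nat) \<times> bool) (s::'a) ls.
    case parent_port k of None \<Rightarrow> a0
    | Some p \<Rightarrow> if fst (fst (fst y)) \<and> snd y then a0 else ls ! p)"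
  have F: "F k y s ls = (case parent_port k of None \<Rightarrow> a0
    | Some p \<Rightarrow> if fst (fst (fst y)) \<and> snd y then a0 else ls ! p)" for k y s ls
    by (simp add: F_def)
  \<comment> \<open>With \<open>L\<close> for \<open>floorlog 2 n\<close> this is
    \<open>Suc L * Suc ?D + ?D + 1\<close>, one more than the bound in
    \<open>label_rank_le\<close>.\<close>
  define R where "R = (\<lambda>n. Suc ?D * floorlog 2 n + (2 * ?D + 2))"
  define st where "st = local_iter F0 F child_label f"
  define lab where "lab = (\<lambda>N. st N (R (card (verts N))))"
  have "congest_computable ?d c (\<lambda>N v. (f N v, local_iter F0 F child_label f N (R (card (verts N))) v))"
  proof (rule congest_computable_iter)
    show "congest_computable ?d c f" using comp by (simp only: f_def)
    show "finite S" by (rule finite_S)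
    show "card S \<le> 2 ^ card S" using less_exp[of "card S"] by simp
    show "(\<lambda>n. real (card S)) \<in> O(\<lambda>n. ln (real n))" using log_bits_bigo[of 0 "card S"] by simp
    show "(\<lambda>n. real (R n)) \<in> O(\<lambda>n. ln (real n))" unfolding R_def by (rule log_bits_bigo)
  qed (simp add: child_label_def cap_in_S)
  from congest_computable_map[OF this, of "\<lambda>k. snd"]
  have "congest_computable ?d c lab" by (simp add: lab_def st_def)
  moreover have "solution \<Pi> N (lab N)" if N: "valid_network ?d c N" for N
  proof -
    interpret selection_network ?d c N m "ms N" "J N" "sel N" by (rule ms[OF N])
    have step: "st N (Suc r) v = (if v = root N \<or> is_cut v \<and> sel N v then a0
        else child_label (initial_knowledge N (up N v))
          (((is_cut (up N v), ms N (up N v)), J N (up N v)), sel N (up N v))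
          (st N r (up N v)) (port_to N (up N v) v))"
      if v: "v \<in> verts N" for r v
    proof (cases "v = root N")
      case True
      then show ?thesis
        unfolding st_def local_iter.simps F[of "initial_knowledge N v"] parent_port_initial by simp
    next
      case False
      then show ?thesis
        unfolding st_def local_iter.simps F[of "initial_knowledge N v"] parent_port_initial
        by (simp only: if_False option.case parent_message[OF v False] f_def fst_conv snd_conv simp_thms)
    qed
    let ?R = "R (card (verts N))"
    have stable: "st N (Suc ?R) v = st N ?R v" if "v \<in> verts N" for v
    proof (rule ranked_iteration_stable[where X = "verts N" and rank = label_rank and g = "st N"])
      fix r r' v
      assume v: "v \<in> verts N"
        and IH: "\<And>w. w \<in> verts N \<Longrightarrow> label_rank w < label_rank v \<Longrightarrow> st N r w = st N r' w"
      show "st N (Suc r) v = st N (Suc r') v"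
      proof (cases "v = root N \<or> is_cut v \<and> sel N v")
        case False
        then have "label_rank (up N v) < label_rank v" using label_rank_up[OF v] by blast
        from IH[OF up_in_verts[OF v] this] show ?thesis unfolding step[OF v] by simp
      qed (simp add: step[OF v])
    next
      have "Suc L * Suc ?D + ?D < ?R" by (simp add: R_def algebra_simps)
      then show "label_rank v < ?R" using label_rank_le[OF that] by linarith
    qed (rule that)
    interpret label_network ?d c N m "ms N" "J N" "sel N" \<Pi> S a0 K W "lab N"
    proof (unfold_locales, rule refl, rule m(2))
      fix v assume v: "v \<in> verts N"
      show "lab N v = (if v = root N \<or> is_cut v \<and> sel N v then a0
        else child_label (initial_knowledge N (up N v))
          (((is_cut (up N v), ms N (up N v)), J N (up N v)), sel N (up N v))
          (lab N (up N v)) (port_to N (up N v) v))"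
        unfolding lab_def using stable[OF v] step[OF v, of ?R] by simp
    qed
    show ?thesis by (rule solution_lab)
  qed
  ultimately show ?thesis by blast
qed

end

theorem theorem5p1:
  fixes \<Pi> :: "'a lcl"
  assumes "lcl_problem \<Pi>"
    and "has_log_certificate \<Pi>"
  shows "congest_solvable \<Pi> (\<lambda>n. ln (real n))"
proof -
  obtain S a0 K W where "flexible_labels \<Pi> S a0 K W"
    using log_certificate_walks[OF assms] assms(1) unfolding flexible_labels_def by metis
  then interpret flexible_labels \<Pi> S a0 K W .
  show ?thesis by (rule congest_solvable_if_computable) (rule labelling_computable)
qed

end
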